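(* Let $\alpha,\beta$ be integers different from $1$ with $v_2(\alpha-1)=v_2(\beta-1)=1$. Then $|G_2|=16$, the nilpotency class of $G_2$ is $3$, $o(a)=o(b)=o(c)=4$, and $G_2$ is isomorphic to the generalized quaternion group $Q_{16}$ of order $16$.
   Context: $G(\alpha,\beta)=\langle A,B\mid A^{[A,B]}=A^{\alpha},\ B^{[B,A]}=B^{\beta}\rangle$ with $[x,y]=x^{-1}y^{-1}xy$, $y^x=x^{-1}yx$, and $C=[A,B]$. The group $G(\alpha,\beta)$ is finite and nilpotent, hence the direct product of its Sylow subgroups; $G_2$ denotes its Sylow $2$-subgroup and $a,b,c$ denote the images of $A,B,C$ under the canonical projection $G(\alpha,\beta)\to G_2$. $v_2$ is the $2$-adic valuation and $o(x)$ the order of $x$. *)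

theory Defs
  imports "HOL-Algebra.Algebra" "HOL-Computational_Algebra.Computational_Algebra"
begin

(* a letter is (generator, inverted?); generator False = A, True = B *)
type_synonym letter = "bool \<times> bool"
type_synonym word = "letter list"

definition inv_letter :: "letter \<Rightarrow> letter" where
  "inv_letter x = (fst x, \<not> snd x)"

definition inv_word :: "word \<Rightarrow> word" where
  "inv_word w = rev (map inv_letter w)"

definition wpow :: "word \<Rightarrow> int \<Rightarrow> word" where
  "wpow w n = (if 0 \<le> n then concat (replicate (nat n) w)
               else concat (replicate (nat (- n)) (inv_word w)))"

definition wA :: word where "wA = [(False, False)]"
definition wB :: word where "wB = [(True, False)]"

definition wC :: word where "wC = inv_word wA @ inv_word wB @ wA @ wB"

text \<open>Congruence on words generated by free cancellation and the two defining relations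
  A^C = C^-1 A C = A^alpha  and  B^[B,A] = C B C^-1 = B^beta.\<close>
inductive weq :: "int \<Rightarrow> int \<Rightarrow> word \<Rightarrow> word \<Rightarrow> bool" for \<alpha> \<beta> where
  weq_refl: "weq \<alpha> \<beta> u u"
| weq_sym: "weq \<alpha> \<beta> u v \<Longrightarrow> weq \<alpha> \<beta> v u"
| weq_trans: "weq \<alpha> \<beta> u v \<Longrightarrow> weq \<alpha> \<beta> v w \<Longrightarrow> weq \<alpha> \<beta> u w"
| weq_cancel: "weq \<alpha> \<beta> (u @ [x, inv_letter x] @ v) (u @ v)"
| weq_rel1: "weq \<alpha> \<beta> (u @ inv_word wC @ wA @ wC @ v) (u @ wpow wA \<alpha> @ v)"
| weq_rel2: "weq \<alpha> \<beta> (u @ wC @ wB @ inv_word wC @ v) (u @ wpow wB \<beta> @ v)"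

definition wclass :: "int \<Rightarrow> int \<Rightarrow> word \<Rightarrow> word set" where
  "wclass \<alpha> \<beta> w = {z. weq \<alpha> \<beta> w z}"

definition Gpres :: "int \<Rightarrow> int \<Rightarrow> word set monoid" where
  "Gpres \<alpha> \<beta> = \<lparr> carrier = range (wclass \<alpha> \<beta>),
      monoid.mult = (\<lambda>p q. {z. \<exists>x\<in>p. \<exists>y\<in>q. weq \<alpha> \<beta> (x @ y) z}),
      one = wclass \<alpha> \<beta> [] \<rparr>"

text \<open>In a finite nilpotent group the Sylow 2-subgroup is the set of 2-elements.\<close>
definition two_elems :: "('a, 'b) monoid_scheme \<Rightarrow> 'a set" where
  "two_elems G = {x \<in> carrier G. \<exists>k::nat. group.ord G x = 2 ^ k}"

definition sylow2 :: "('a, 'b) monoid_scheme \<Rightarrow> ('a, 'b) monoid_scheme" where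
  "sylow2 G = G\<lparr>carrier := two_elems G\<rparr>"

text \<open>2-component of x: the unique power of x of 2-power order whose cofactor has odd order.
  In a finite nilpotent group this is the image of x under the canonical projection onto G_2.\<close>
definition proj2 :: "('a, 'b) monoid_scheme \<Rightarrow> 'a \<Rightarrow> 'a" where
  "proj2 G x = (THE y. y \<in> carrier G \<and> (\<exists>n::nat. y = x [^]\<^bsub>G\<^esub> n)
        \<and> (\<exists>k::nat. group.ord G y = 2 ^ k) \<and> odd (group.ord G (x \<otimes>\<^bsub>G\<^esub> inv\<^bsub>G\<^esub> y)))"

definition commutator :: "('a, 'b) monoid_scheme \<Rightarrow> 'a \<Rightarrow> 'a \<Rightarrow> 'a" where
  "commutator G x y = inv\<^bsub>G\<^esub> x \<otimes>\<^bsub>G\<^esub> inv\<^bsub>G\<^esub> y \<otimes>\<^bsub>G\<^esub> x \<otimes>\<^bsub>G\<^esub> y"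

(* lcs G 0 = gamma_1 = G, lcs G (Suc n) = gamma_(n+2) = [gamma_(n+1), G] *)
fun lcs :: "('a, 'b) monoid_scheme \<Rightarrow> nat \<Rightarrow> 'a set" where
  "lcs G 0 = carrier G"
| "lcs G (Suc n) = generate G {commutator G x y | x y. x \<in> lcs G n \<and> y \<in> carrier G}"

definition nilpotency_class :: "('a, 'b) monoid_scheme \<Rightarrow> nat \<Rightarrow> bool" where
  "nilpotency_class G c \<longleftrightarrow> lcs G c = {\<one>\<^bsub>G\<^esub>} \<and> (\<forall>i<c. lcs G i \<noteq> {\<one>\<^bsub>G\<^esub>})"

section \<open>Generalized quaternion group Q16 = <x,y | x^8 = 1, y^2 = x^4, y^-1 x y = x^-1>\<close>

text \<open>Element (i,j) stands for x^i y^j, 0 <= i < 8, 0 <= j < 2.\<close>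
definition Q16 :: "(int \<times> int) monoid" where
  "Q16 = \<lparr> carrier = {0..<8} \<times> {0..<2},
     monoid.mult = (\<lambda>(i, j) (k, l). ((i + (if j = 0 then k else - k) + (if j = 1 \<and> l = 1 then 4 else 0)) mod 8,
                             (j + l) mod 2)),
     one = (0, 0) \<rparr>"

end

theory Submission
  imports Defs "HOL-Number_Theory.Number_Theory"
begin

text \<open>
  Put \<open>s(n) = 1 + \<alpha> + \<dots> + \<alpha>\<^sup>n\<^sup>-\<^sup>1\<close>. Everything rests on the two consequences
  \<open>B\<^sup>-\<^sup>1 A\<^sup>n B = C\<^sup>n A\<^sup>\<alpha>\<^sup>s\<^sup>(\<^sup>n\<^sup>)\<close> and \<open>A\<^sup>-\<^sup>1 C\<^sup>n A = C\<^sup>n A\<^sup>k\<close>, where \<open>k = 1 - \<alpha>\<^sup>n\<close>, of the first relation and their mirror images.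

  Finiteness: computing \<open>[A, B\<^sup>\<beta>]\<close> in two ways gives an element that lies both in \<open>R C\<^sup>\<alpha>\<close> and in
  \<open>R' C\<^sup>\<beta>\<close>, where \<open>R\<close> and \<open>R'\<close> are abelian groups containing \<open>A\<close> and \<open>B\<close>. If \<open>\<alpha> \<noteq> \<beta>\<close> then some
  nontrivial power of \<open>C\<close> lies in \<open>R\<close>; if \<open>\<alpha> = \<beta>\<close> then some nontrivial power of \<open>B\<close> is central.

  A prime dividing the order of \<open>A\<close> divides \<open>\<alpha> - 1\<close>, as one sees by considering a largest
  exception. Hence \<open>s(n)\<close> is divisible by as much as \<open>n\<close> is, and since \<open>4\<close> divides \<open>\<alpha> + 1\<close> the
  powers of 2 in the orders can be lowered until \<open>A\<^sup>4\<^sup>m = B\<^sup>4\<^sup>m = 1\<close> for some \<open>m\<close> congruent to 1 modulo 4.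
  Then \<open>x = A\<^sup>m B\<^sup>m\<close> and \<open>y = A\<^sup>m\<close> satisfy the relations of \<open>Q\<^sub>1\<^sub>6\<close>, the resulting
  homomorphism from \<open>Q\<^sub>1\<^sub>6\<close> is split by the homomorphism \<open>A \<mapsto> y\<close>, \<open>B \<mapsto> x\<^sup>3 y\<close>, its image \<open>P\<close> is normal,
  and \<open>G\<close> is the product of \<open>P\<close> with the cyclic groups generated by \<open>B\<close>, \<open>C\<close>, \<open>A\<close>, whose
  \<open>m\<close>-th powers lie in \<open>P\<close>; so \<open>P\<close> has odd index.
\<close>

section \<open>Geometric sums\<close>

hide_const (open) Divisibility.prime

text \<open>The exponent of \<open>A\<close> that appears when a power of
  \<open>A \<otimes> C\<close> is collected with all \<open>C\<close> on the left; see
  \<open>AC_pow\<close>.\<close>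

definition geom_sum :: "int \<Rightarrow> nat \<Rightarrow> int" where
  "geom_sum a n = (\<Sum>i<n. a ^ i)"

lemma geom_sum_0 [simp]: "geom_sum a 0 = 0" by (simp add: geom_sum_def)
lemma geom_sum_Suc: "geom_sum a (Suc n) = geom_sum a n + a ^ n" by (simp add: geom_sum_def)

lemma geom_sum_telescope: "(a - 1) * geom_sum a n = a ^ n - 1"
  by (simp add: geom_sum_def power_diff_1_eq)

lemma geom_sum_add: "geom_sum a (m + n) = geom_sum a m + a ^ m * geom_sum a n"
  by (induction n) (simp_all add: geom_sum_Suc power_add algebra_simps)

lemma geom_sum_mult: "geom_sum a (m * n) = geom_sum a m * geom_sum (a ^ m) n"
proof (induction n)
  case (Suc n)
  have "geom_sum a (m * Suc n) = geom_sum a (m * n + m)" by (simp add: add.commute)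
  also have "\<dots> = geom_sum a (m * n) + (a ^ m) ^ n * geom_sum a m" by (simp only: geom_sum_add power_mult)
  finally show ?case using Suc by (simp add: geom_sum_Suc algebra_simps)
qed simp

lemma geom_sum_cong: "[a = b] (mod q) \<Longrightarrow> [geom_sum a n = geom_sum b n] (mod q)"
  unfolding geom_sum_def by (intro cong_sum cong_pow)

lemma geom_sum_cong_one:
  assumes "q dvd a - 1" shows "[geom_sum a n = int n] (mod q)"
proof -
  have "[a = 1] (mod q)" using assms by (simp add: cong_iff_dvd_diff)
  from geom_sum_cong[OF this, of n] show ?thesis by (simp add: geom_sum_def)
qed

section \<open>Divisibility tested on prime powers\<close>

lemma dvd_if_prime_powers_dvd:
  fixes x y :: int
  assumes "x \<noteq> 0" and "\<And>q f. prime q \<Longrightarrow> 0 < f \<Longrightarrow> q ^ f dvd x \<Longrightarrow> q ^ f dvd y"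
  shows "x dvd y"
proof (cases "y = 0")
  case False
  show ?thesis
  proof (rule multiplicity_le_imp_dvd)
    show "x \<noteq> 0" by fact
    fix q :: int assume q: "prime q"
    show "multiplicity q x \<le> multiplicity q y"
    proof (cases "multiplicity q x = 0")
      case nz: False
      have "q ^ multiplicity q x dvd y"
        by (rule assms(2)[OF q]) (use nz in \<open>simp_all add: multiplicity_dvd\<close>)
      then show ?thesis
        using False q by (intro multiplicity_geI) (auto simp: prime_def prime_elem_def)
    qed simp
  qed
qed simp

text \<open>Induction on \<open>f\<close> with \<open>geom_sum a (q * q ^ f) = geom_sum a q *
  geom_sum (a ^ q) (q ^ f)\<close>: the first factor is congruent to \<open>q\<close> modulo
  \<open>q\<close>, and \<open>a ^ q\<close> is again congruent to 1.\<close>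

lemma prime_power_dvd_geom_sum:
  fixes q :: nat
  assumes "prime q" "q ^ f dvd n" "int q dvd a - 1"
  shows "int q ^ f dvd geom_sum a n"
proof -
  have pw: "int q ^ f dvd geom_sum a (q ^ f)" if "int q dvd a - 1" for a
    using that
  proof (induction f arbitrary: a)
    case (Suc f)
    have "int q dvd geom_sum a q"
      using geom_sum_cong_one[OF Suc.prems, of q] by (simp add: cong_dvd_iff)
    moreover have "int q dvd a ^ q - 1"
      using Suc.prems geom_sum_telescope[of a q] by (metis dvd_mult2)
    then have "int q ^ f dvd geom_sum (a ^ q) (q ^ f)" by (rule Suc.IH)
    ultimately show ?case by (simp add: geom_sum_mult mult_dvd_mono)
  qed simp
  from assms(2) obtain j where "n = q ^ f * j" by (elim dvdE)
  then show ?thesis using pw[OF assms(3)] by (simp add: geom_sum_mult)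
qed

lemma dvd_if_nat_prime_powers_dvd:
  assumes "0 < d" and "\<And>q f. prime q \<Longrightarrow> 0 < f \<Longrightarrow> q ^ f dvd d \<Longrightarrow> q dvd d \<Longrightarrow> int q ^ f dvd y"
  shows "int d dvd y"
proof (rule dvd_if_prime_powers_dvd)
  show "int d \<noteq> 0" using assms(1) by simp
  fix q :: int and f assume q: "prime q" "0 < f" "q ^ f dvd int d"
  define r where "r = nat q"
  have r: "q = int r" using q(1) by (simp add: r_def prime_ge_0_int)
  have "prime r" "r ^ f dvd d" using q by (simp_all add: r flip: int_dvd_int_iff)
  moreover have "r dvd d" using q(2) \<open>r ^ f dvd d\<close> by (meson dvd_power dvd_trans)
  ultimately show "q ^ f dvd y" unfolding r using assms(2) q(2) by blast
qed

lemma dvd_geom_sum_self: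
  assumes "0 < d" and "\<And>q. prime q \<Longrightarrow> q dvd d \<Longrightarrow> int q dvd a - 1"
  shows "int d dvd geom_sum a d"
  by (rule dvd_if_nat_prime_powers_dvd[OF assms(1)]) (simp add: prime_power_dvd_geom_sum assms(2))

lemma dvd_geom_sum:
  assumes "0 < d" "d dvd n" "\<And>q. prime q \<Longrightarrow> q dvd d \<Longrightarrow> int q dvd a - 1"
  shows "int d dvd geom_sum a n"
proof -
  from assms(2) obtain j where "n = d * j" by (elim dvdE)
  then show ?thesis using dvd_geom_sum_self[OF assms(1,3)] by (simp add: geom_sum_mult)
qed

text \<open>In \<open>t ^ p - 1 = (t - 1) * geom_sum t p\<close> the sum is congruent to
  \<open>p\<close> modulo \<open>q\<close>, so the whole power of \<open>q\<close> sits in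
  \<open>t - 1\<close>.\<close>

lemma prime_power_dvd_root:
  fixes p q :: nat
  assumes "prime p" "prime q" "p \<noteq> q" "int q dvd t - 1" "int q ^ f dvd t ^ p - 1"
  shows "int q ^ f dvd t - 1"
proof -
  have "coprime (int q) (int p)"
    using assms by (simp add: primes_coprime)
  then have "coprime (int q) (geom_sum t p)"
    using cong_imp_coprime geom_sum_cong_one[OF assms(4), of p] cong_sym by (metis coprime_commute)
  then have "coprime (int q ^ f) (geom_sum t p)" by simp
  moreover have "int q ^ f dvd (t - 1) * geom_sum t p" using assms(5) by (simp add: geom_sum_telescope)
  ultimately show ?thesis by (simp add: coprime_dvd_mult_left_iff)
qed

lemma fermat_int:
  assumes "prime (q::nat)" "\<not> int q dvd t"
  shows "[t ^ (q - 1) = 1] (mod int q)"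
proof -
  define y where "y = nat (t mod int q)"
  have y: "int y = t mod int q" using assms(1) by (simp add: y_def prime_gt_0_nat)
  have "\<not> q dvd y" using assms(2) y by (metis dvd_mod_iff dvd_refl int_dvd_int_iff)
  then have "[y ^ (q - 1) = 1] (mod q)" by (rule fermat_theorem[OF assms(1)])
  then have "[int y ^ (q - 1) = 1] (mod int q)" by (metis cong_int_iff of_nat_1 of_nat_power)
  moreover have "[t = int y] (mod int q)" by (simp add: y cong_def)
  ultimately show ?thesis using cong_pow cong_trans by blast
qed

text \<open>By Fermat the order of \<open>t\<close> modulo \<open>q\<close> divides
  \<open>q - 1\<close> as well as \<open>p\<close>, and these are coprime because
  \<open>q - 1 < p\<close>.\<close>

lemma prime_dvd_root:
  fixes p q :: nat
  assumes "prime p" "prime q" "q < p" "int q dvd t ^ p - 1"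
  shows "int q dvd t - 1"
proof -
  have t: "[t ^ p = 1] (mod int q)" using assms(4) by (simp add: cong_iff_dvd_diff)
  have "\<not> int q dvd t"
  proof
    assume "int q dvd t"
    then have "int q dvd t ^ p" using assms(1) by (meson dvd_power dvd_trans prime_gt_0_nat)
    then have "int q dvd 1" using assms(4) by (metis dvd_diff_right_iff)
    then show False using assms(2) by (metis not_prime_unit prime_nat_int_transfer)
  qed
  then have F: "[t ^ (q - 1) = 1] (mod int q)" by (rule fermat_int[OF assms(2)])
  have "\<not> p dvd q - 1" using prime_gt_1_nat[OF assms(2)] assms(3) by (auto dest!: dvd_imp_le)
  then have cop: "coprime p (q - 1)" using assms(1) by (simp add: prime_imp_coprime)
  have "[t = 1] (mod int q)"
  \<comment> \<open>The Bezout identity over the natural numbers excludes the modulus 1, that is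
    \<open>q = 2\<close>, where Fermat already gives the claim.\<close>
  proof (cases "q - 1 = 1")
    case True
    then show ?thesis using F by simp
  next
    case False
    obtain u v where uv: "p * u = (q - 1) * v + 1"
      using coprime_bezout_strong[OF cop False] by blast
    have "(t ^ p) ^ u = (t ^ (q - 1)) ^ v * t"
      unfolding power_mult[symmetric] uv by simp
    moreover have "[(t ^ p) ^ u = 1 ^ u] (mod int q)" using t by (rule cong_pow)
    moreover have "[(t ^ (q - 1)) ^ v * t = 1 ^ v * t] (mod int q)"
      using F by (intro cong_mult cong_pow cong_refl)
    ultimately show ?thesis by (simp add: cong_def)
  qed
  then show ?thesis by (simp add: cong_iff_dvd_diff)
qed

text \<open>The factor \<open>geom_sum t p\<close> of \<open>t ^ p - 1\<close> is \<open>p\<close>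
  times an integer prime to \<open>p\<close>, so only one factor \<open>p\<close> is lost. Oddness
  makes the sum of the integers below \<open>p\<close> divisible by \<open>p\<close>.\<close>

lemma odd_prime_power_dvd_root:
  fixes p :: nat
  assumes "prime p" "odd p" "int p dvd t - 1" "int p ^ f dvd t ^ p - 1"
  shows "int p ^ f dvd (t - 1) * int p"
proof -
  \<comment> \<open>Second-order expansion at \<open>t = 1\<close>; its remainder again consists of
    geometric sums, which are known modulo \<open>p\<close>.\<close>
  have gsum: "geom_sum t n = int n + (t - 1) * (\<Sum>i<n. geom_sum t i)" for n
  proof (induction n)
    case (Suc n)
    have "(t - 1) * (\<Sum>i<Suc n. geom_sum t i) = (t - 1) * (\<Sum>i<n. geom_sum t i) + (t ^ n - 1)"
      by (simp add: distrib_left geom_sum_telescope)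
    then show ?case using Suc by (simp add: geom_sum_Suc)
  qed simp
  have "[(\<Sum>i<p. geom_sum t i) = (\<Sum>i<p. int i)] (mod int p)"
    by (intro cong_sum geom_sum_cong_one assms)
  moreover have "int p dvd (\<Sum>i<p. int i)"
  proof -
    have "2 * (\<Sum>i<p. int i) = int p * (int p - 1)" by (induction p) (auto simp: algebra_simps)
    then have "int p dvd 2 * (\<Sum>i<p. int i)" by simp
    moreover have "coprime (int p) 2" using assms(2) by simp
    ultimately show ?thesis by (simp add: coprime_dvd_mult_right_iff)
  qed
  ultimately have "int p dvd (\<Sum>i<p. geom_sum t i)" by (simp add: cong_dvd_iff)
  then obtain w where w: "(\<Sum>i<p. geom_sum t i) = int p * w" by (elim dvdE)
  obtain v where v: "t - 1 = int p * v" using assms(3) by (elim dvdE)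
  have g: "geom_sum t p = int p * (1 + (t - 1) * w)" by (subst gsum) (simp add: w algebra_simps)
  have "coprime (int p) (1 + (t - 1) * w)"
    unfolding v by (metis coprime_1_right gcd.commute gcd_add_mult coprime_iff_gcd_eq_1 mult.assoc mult.commute add.commute)
  then have "coprime (int p ^ f) (1 + (t - 1) * w)" by simp
  moreover have "int p ^ f dvd (t - 1) * int p * (1 + (t - 1) * w)"
    using assms(4) geom_sum_telescope[of t p] by (simp add: g mult.assoc)
  ultimately show ?thesis by (simp add: coprime_dvd_mult_left_iff)
qed

lemma prime_power_dvd_power_minus_one:
  fixes p :: nat
  assumes "prime p" "int p dvd t - 1"
  shows "int p ^ Suc i dvd t ^ (p ^ i) - 1"
proof -
  have "int p ^ Suc i dvd (t - 1) * geom_sum t (p ^ i)"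
    using prime_power_dvd_geom_sum[OF assms(1) dvd_refl assms(2), of i] assms(2) by (simp add: mult_dvd_mono)
  then show ?thesis by (simp add: geom_sum_telescope)
qed

text \<open>Modulo \<open>p\<close> every integer equals its \<open>p\<close>-th power, so the
  powers can be stripped one by one.\<close>

lemma prime_dvd_power_prime_power_minus_one:
  fixes p :: nat
  assumes "prime p" "int p dvd t ^ (p ^ i) - 1"
  shows "int p dvd t - 1"
  using assms(2)
proof (induction i)
  case (Suc i)
  define Y where "Y = t ^ (p ^ i)"
  have Yp: "int p dvd Y ^ p - 1" unfolding Y_def using Suc.prems by (metis power_Suc power_mult mult.commute)
  have "[Y ^ p = Y] (mod int p)"
  proof (cases "int p dvd Y")
    case True
    then have "int p dvd Y ^ p" using assms(1) by (meson dvd_power dvd_trans prime_gt_0_nat)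
    with True show ?thesis by (simp add: cong_iff_dvd_diff)
  next
    case False
    then have "[Y ^ (p - 1) * Y = 1 * Y] (mod int p)" by (intro cong_mult fermat_int assms(1) cong_refl)
    moreover have "Y ^ (p - 1) * Y = Y ^ p"
      using assms(1) by (metis power_minus_mult prime_gt_0_nat)
    ultimately show ?thesis by simp
  qed
  then have "int p dvd Y - 1" using Yp by (metis cong_diff cong_dvd_iff cong_refl)
  then show ?case unfolding Y_def by (rule Suc.IH)
qed simp

lemma power_mod_4:
  fixes a :: int
  assumes "a mod 4 = 3" "odd n" shows "a ^ n mod 4 = 3"
proof -
  have "[a = - 1] (mod 4)" using assms by (simp add: cong_def)
  then have "[a ^ n = (- 1) ^ n] (mod 4)" by (rule cong_pow)
  then show ?thesis using assms(2) by (simp add: cong_def)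
qed

lemma geom_sum_mod_4:
  assumes "a mod 4 = 3" "odd n" shows "geom_sum a n mod 4 = 1"
proof -
  have gs1: "geom_sum (- 1) n = (if even n then 0 else 1)" for n
    by (induction n) (simp_all add: geom_sum_Suc)
  have "[a = - 1] (mod 4)" using assms by (simp add: cong_def)
  then have "[geom_sum a n = geom_sum (- 1) n] (mod 4)" by (rule geom_sum_cong)
  then show ?thesis using assms(2) by (simp add: cong_def gs1)
qed

text \<open>Write \<open>n = p ^ i * m\<close> with \<open>p\<close> not dividing \<open>m\<close>;
  then \<open>f\<close> is at most \<open>i + 1\<close>. Fermat brings divisibility by
  \<open>p\<close> down to \<open>t ^ m - 1\<close>, and each of the \<open>i\<close> further
  \<open>p\<close>-th powers gains a factor \<open>p\<close>.\<close>

lemma prime_power_dvd_power_minus_one_descent: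
  fixes p :: nat
  assumes p: "prime p" and n: "0 < n" and f: "0 < f" "p ^ f dvd n * p" and t: "int p dvd t ^ (n * p) - 1"
  shows "int p ^ f dvd t ^ n - 1"
proof -
  obtain i m where m: "n = p ^ i * m" "\<not> p dvd m"
    using n p by (metis multiplicity_decompose' not_prime_unit not_gr0)
  have "p ^ f dvd p ^ Suc i * m" using f m by (simp add: mult_ac)
  then have "p ^ f dvd p ^ Suc i" using m(2) p by (metis coprime_dvd_mult_left_iff coprime_power_left_iff prime_imp_coprime)
  then have "f \<le> Suc i" using p prime_gt_1_nat by (simp add: power_dvd_imp_le)
  then have "int p ^ f dvd int p ^ Suc i" by (rule le_imp_power_dvd)
  moreover have "t ^ (n * p) = (t ^ m) ^ (p ^ Suc i)" unfolding m by (simp add: mult_ac flip: power_mult)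
  then have "int p dvd t ^ m - 1" using t p prime_dvd_power_prime_power_minus_one by metis
  then have "int p ^ Suc i dvd (t ^ m) ^ (p ^ i) - 1" by (rule prime_power_dvd_power_minus_one[OF p])
  then have "int p ^ Suc i dvd t ^ n - 1" unfolding m by (metis power_mult mult.commute)
  ultimately show ?thesis using dvd_trans by blast
qed

lemma int_power_dvd: "q ^ f dvd d \<Longrightarrow> int d dvd y \<Longrightarrow> int q ^ f dvd y"
  by (metis dvd_trans int_dvd_int_iff of_nat_power)

text \<open>If \<open>q\<close> divides \<open>t - 1\<close>, then \<open>q\<close> differs from
  \<open>p\<close>, \<open>q ^ f\<close> divides \<open>n\<close>, and the sum inherits this. If
  \<open>q = p\<close> the descent lemma applies, and if \<open>q < p\<close> the root lemmas do; in
  both cases \<open>t - 1\<close> is invertible modulo \<open>q\<close>, so divisibility passes from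
  \<open>t ^ n - 1\<close> to the sum.\<close>

lemma dvd_geom_sum_if_largest_bad_prime:
  fixes p :: nat
  assumes p: "prime p" "\<not> int p dvd t - 1" and n: "0 < n"
    and d: "0 < d" "d dvd n * p" "int d dvd t ^ (n * p) - 1"
    and large: "\<And>q. prime q \<Longrightarrow> q dvd d \<Longrightarrow> int q dvd t - 1 \<or> q \<le> p"
  shows "int d dvd geom_sum t n"
proof (rule dvd_if_nat_prime_powers_dvd[OF d(1)])
  fix q f assume q: "prime q" "0 < f" "q ^ f dvd d" "q dvd d"
  have qt: "int q ^ f dvd t ^ (n * p) - 1" using q d by (meson int_power_dvd)
  have q1: "int q dvd t ^ (n * p) - 1" using q(4) d(3) by (meson dvd_trans int_dvd_int_iff)
  have final: "int q ^ f dvd geom_sum t n" if "int q ^ f dvd t ^ n - 1" "\<not> int q dvd t - 1"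
  proof -
    have "coprime (int q) (t - 1)" using q(1) that(2) by (simp add: prime_imp_coprime)
    then have "coprime (int q ^ f) (t - 1)" by simp
    moreover have "int q ^ f dvd (t - 1) * geom_sum t n" using that(1) by (simp add: geom_sum_telescope)
    ultimately show ?thesis by (simp add: coprime_dvd_mult_right_iff)
  qed
  show "int q ^ f dvd geom_sum t n"
  proof (cases "int q dvd t - 1")
    case True
    then have "q \<noteq> p" using p by blast
    then have "coprime q p" using p(1) q(1) by (simp add: primes_coprime)
    moreover have "q ^ f dvd n * p" using q(3) d(2) by (rule dvd_trans)
    ultimately have "q ^ f dvd n" by (simp add: coprime_dvd_mult_left_iff)
    then show ?thesis using prime_power_dvd_geom_sum q(1) True by blast
  next
    case False
    show ?thesis
    proof (cases "q = p")
      case True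
      then show ?thesis
        using prime_power_dvd_power_minus_one_descent[OF p(1) n q(2), of t] q d(2) q1 False
        by (intro final) (auto intro: dvd_trans)
    next
      case neq: False
      then have "q < p" using large[OF q(1,4)] False by simp
      have "int q dvd (t ^ n) ^ p - 1" using q1 by (simp add: power_mult)
      then have "int q dvd t ^ n - 1" using prime_dvd_root[OF p(1) q(1) \<open>q < p\<close>] by blast
      moreover have "int q ^ f dvd (t ^ n) ^ p - 1" using qt by (simp add: power_mult)
      ultimately have "int q ^ f dvd t ^ n - 1" using prime_power_dvd_root p(1) q(1) neq by metis
      then show ?thesis using final False by blast
    qed
  qed
qed

text \<open>Replacing the exponent \<open>n * p\<close> by \<open>n\<close> keeps the powers of the
  primes other than \<open>p\<close>. If \<open>p\<close> divides \<open>t - 1\<close>, at most one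
  factor \<open>p\<close> is lost and the extra factor \<open>t - 1\<close> restores it; otherwise
  \<open>pp\<close> makes the descent lemma applicable.\<close>

lemma dvd_mult_if_largest_bad_prime:
  fixes p :: nat
  assumes p: "prime p" "odd p" and n: "0 < n"
    and d: "0 < d" "int d dvd t ^ (n * p) - 1"
    and large: "\<And>q. prime q \<Longrightarrow> q dvd d \<Longrightarrow> int q dvd t - 1 \<or> q \<le> p"
    and pp: "int p dvd t - 1 \<or> (\<forall>f. p ^ f dvd d \<longrightarrow> p ^ f dvd n * p)"
  shows "int d dvd (t ^ n - 1) * (t - 1)"
proof (rule dvd_if_nat_prime_powers_dvd[OF d(1)])
  fix q f assume q: "prime q" "0 < f" "q ^ f dvd d" "q dvd d"
  have qt: "int q ^ f dvd (t ^ n) ^ p - 1" using int_power_dvd[OF q(3) d(2)] by (simp add: power_mult)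
  have q1: "int q dvd t ^ (n * p) - 1" using q(4) d(2) by (meson dvd_trans int_dvd_int_iff)
  have tn: "t - 1 dvd t ^ n - 1" using geom_sum_telescope[of t n] by (metis dvd_triv_left)
  show "int q ^ f dvd (t ^ n - 1) * (t - 1)"
  proof (cases "q = p")
    case True
    show ?thesis
    proof (cases "int p dvd t - 1")
      case True
      have "int p ^ f dvd (t ^ n - 1) * int p"
        using odd_prime_power_dvd_root[OF p, of "t ^ n" f] dvd_trans[OF True tn] qt \<open>q = p\<close> by blast
      also have "(t ^ n - 1) * int p dvd (t ^ n - 1) * (t - 1)" using True by (rule mult_dvd_mono[OF dvd_refl])
      finally show ?thesis using \<open>q = p\<close> by simp
    next
      case False
      then have "p ^ f dvd n * p" using pp q(3) \<open>q = p\<close> by blast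
      then show ?thesis
        using prime_power_dvd_power_minus_one_descent[OF p(1) n q(2), of t] q1 \<open>q = p\<close> by auto
    qed
  next
    case False
    have "int q dvd t ^ n - 1"
    proof (cases "int q dvd t - 1")
      case True
      then show ?thesis using tn dvd_trans by blast
    next
      case bad: False
      then have "q < p" using large[OF q(1,4)] False by simp
      moreover have "int q dvd (t ^ n) ^ p - 1" using q1 by (simp add: power_mult)
      ultimately show ?thesis using prime_dvd_root[OF p(1) q(1)] by blast
    qed
    then have "int q ^ f dvd t ^ n - 1" using prime_power_dvd_root p(1) q(1) False qt by metis
    then show ?thesis by simp
  qed
qed

section \<open>Conjugation\<close>

context group
begin

text \<open>\<open>cj g x\<close> is \<open>x\<^sup>g\<close> in the notation of the paper.\<close>

definition cj :: "'a \<Rightarrow> 'a \<Rightarrow> 'a" where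
  "cj g x = inv g \<otimes> x \<otimes> g"

lemma cj_closed [simp]: "g \<in> carrier G \<Longrightarrow> x \<in> carrier G \<Longrightarrow> cj g x \<in> carrier G"
  by (simp add: cj_def)

lemma cj_one [simp]: "g \<in> carrier G \<Longrightarrow> cj g \<one> = \<one>"
  by (simp add: cj_def)

lemma cj_by_one [simp]: "x \<in> carrier G \<Longrightarrow> cj \<one> x = x"
  by (simp add: cj_def)

lemma cj_mult:
  assumes "g \<in> carrier G" "x \<in> carrier G" "y \<in> carrier G"
  shows "cj g (x \<otimes> y) = cj g x \<otimes> cj g y"
proof -
  have "g \<otimes> (inv g \<otimes> (y \<otimes> g)) = y \<otimes> g" using assms by (simp flip: m_assoc)
  then show ?thesis using assms by (simp add: cj_def m_assoc)
qed

lemma cj_hom: "g \<in> carrier G \<Longrightarrow> cj g \<in> hom G G"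
  by (simp add: hom_def cj_mult Pi_iff)

lemma cj_group_hom: "g \<in> carrier G \<Longrightarrow> group_hom G G (cj g)"
  by (simp add: group_hom_def group_hom_axioms_def cj_hom is_group)

lemma cj_inv: "g \<in> carrier G \<Longrightarrow> x \<in> carrier G \<Longrightarrow> cj g (inv x) = inv (cj g x)"
  using cj_group_hom group_hom.hom_inv by metis

lemma cj_int_pow: "g \<in> carrier G \<Longrightarrow> x \<in> carrier G \<Longrightarrow> cj g (x [^] (i::int)) = cj g x [^] i"
  using cj_group_hom group_hom.hom_int_pow by metis

lemma cj_nat_pow: "g \<in> carrier G \<Longrightarrow> x \<in> carrier G \<Longrightarrow> cj g (x [^] (i::nat)) = cj g x [^] i"
  using cj_group_hom group_hom.hom_nat_pow by metis

lemma cj_by_mult: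
  assumes "g \<in> carrier G" "h \<in> carrier G" "x \<in> carrier G"
  shows "cj (g \<otimes> h) x = cj h (cj g x)"
  using assms by (simp add: cj_def inv_mult_group m_assoc)

lemma cj_by_inv_cancel [simp]:
  assumes "g \<in> carrier G" "x \<in> carrier G"
  shows "cj (inv g) (cj g x) = x" "cj g (cj (inv g) x) = x"
  using assms cj_by_mult[of g "inv g" x] cj_by_mult[of "inv g" g x] by simp_all

lemma cj_eqD: "g \<in> carrier G \<Longrightarrow> x \<in> carrier G \<Longrightarrow> y \<in> carrier G \<Longrightarrow> cj g x = cj g y \<Longrightarrow> x = y"
  by (metis cj_by_inv_cancel(1))

lemma mult_cj: "g \<in> carrier G \<Longrightarrow> x \<in> carrier G \<Longrightarrow> g \<otimes> cj g x = x \<otimes> g"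
  by (simp add: cj_def m_assoc[symmetric])

lemma cj_fixed_iff:
  assumes "g \<in> carrier G" "x \<in> carrier G"
  shows "cj g x = x \<longleftrightarrow> g \<otimes> x = x \<otimes> g"
  using assms mult_cj[of g x] by (metis cj_closed l_cancel)

lemma cj_fixed_sym:
  assumes "g \<in> carrier G" "x \<in> carrier G" "cj g x = x"
  shows "cj x g = g"
  using assms by (simp add: cj_fixed_iff)

lemma cj_pow_self: "x \<in> carrier G \<Longrightarrow> cj (x [^] (i::int)) (x [^] (j::int)) = x [^] j"
  by (simp add: cj_fixed_iff int_pow_mult[symmetric] add.commute)

lemma cj_by_pow_fixed:
  assumes "g \<in> carrier G" "x \<in> carrier G" "cj g x = x"
  shows "cj (g [^] (i::int)) x = x"
  by (rule cj_fixed_sym) (use assms in \<open>simp_all add: cj_int_pow cj_fixed_sym\<close>)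

lemma cj_by_nat_pow_power:
  assumes "g \<in> carrier G" "x \<in> carrier G" "cj g x = x [^] (s::int)"
  shows "cj (g [^] (n::nat)) (x [^] (i::int)) = x [^] (i * s ^ n)"
proof (induction n)
  case (Suc n)
  have "cj (g [^] Suc n) (x [^] i) = cj g (x [^] (i * s ^ n))"
    using assms(1,2) Suc by (simp add: cj_by_mult)
  also have "\<dots> = x [^] (s * (i * s ^ n))" using assms by (simp add: cj_int_pow int_pow_pow)
  finally show ?case by (simp add: mult_ac)
qed (use assms in simp)

lemma int_pow_eq_one_iff: "x \<in> carrier G \<Longrightarrow> x [^] (i::int) = \<one> \<longleftrightarrow> int (ord x) dvd i"
  by (simp add: int_pow_eq_id)

lemma int_pow_eq_iff_dvd: "x \<in> carrier G \<Longrightarrow> x [^] (i::int) = x [^] (j::int) \<longleftrightarrow> int (ord x) dvd i - j"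
  using int_pow_eq[of x j i] by auto

lemma ord_pos_iff:
  assumes "x \<in> carrier G"
  shows "0 < ord x \<longleftrightarrow> (\<exists>i::int. i \<noteq> 0 \<and> x [^] i = \<one>)"
proof
  assume "0 < ord x"
  then show "\<exists>i::int. i \<noteq> 0 \<and> x [^] i = \<one>" using assms
    by (intro exI[of _ "int (ord x)"]) (simp add: int_pow_int)
next
  assume "\<exists>i::int. i \<noteq> 0 \<and> x [^] i = \<one>"
  then show "0 < ord x" using int_pow_eq_one_iff[OF assms] by (metis dvd_0_left gr0I of_nat_0)
qed

end

section \<open>Finiteness of the orders of the generators\<close>

text \<open>The defining equation of \<open>C = [A, B]\<close> is stated as \<open>A\<^sup>B = A C\<close>; inverting it shows that
  exchanging \<open>A\<close> and \<open>B\<close> replaces \<open>C\<close> by its inverse.\<close>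

locale macdonald = group G for G (structure) +
  fixes A B C :: 'a and \<alpha> \<beta> :: int
  assumes A_closed [simp]: "A \<in> carrier G" and B_closed [simp]: "B \<in> carrier G"
    and C_closed [simp]: "C \<in> carrier G"
    and cj_B_A: "cj B A = A \<otimes> C"
    and cj_C_A: "cj C A = A [^] \<alpha>"
    and cj_inv_C_B: "cj (inv C) B = B [^] \<beta>"
begin

lemma C_mult_cj: "x \<in> carrier G \<Longrightarrow> C \<otimes> cj C x = x \<otimes> C"
  by (simp add: mult_cj)

lemma cj_A_B: "cj A B = B \<otimes> inv C"
proof -
  have "A \<otimes> B = B \<otimes> (A \<otimes> C)" using mult_cj[of B A] by (simp add: cj_B_A)
  then have "A \<otimes> (B \<otimes> inv C) = B \<otimes> A"
    by (metis A_closed B_closed C_closed inv_closed inv_solve_right m_assoc m_closed)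
  then have "A \<otimes> cj A B = A \<otimes> (B \<otimes> inv C)" by (simp add: mult_cj)
  then show ?thesis by simp
qed

text \<open>This symmetry turns each statement about \<open>A\<close> into one about
  \<open>B\<close>; its interpretations under the prefix \<open>S\<close> supply the mirror images
  below.\<close>

lemma swap: "macdonald G B A (inv C) \<beta> \<alpha>"
  by unfold_locales (simp_all add: cj_A_B cj_inv_C_B cj_C_A)

text \<open>Moving \<open>C\<close> to the left past a power of \<open>A\<close> multiplies the
  exponent by \<open>\<alpha>\<close>, so the exponents \<open>\<alpha>\<close>,
  \<open>\<alpha> ^ 2\<close>, up to \<open>\<alpha> ^ n\<close> are summed.\<close>

lemma AC_pow: "(A \<otimes> C) [^] (n::nat) = C [^] n \<otimes> A [^] (\<alpha> * geom_sum \<alpha> n)"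
proof (induction n)
  case (Suc n)
  have AC: "A \<otimes> C = C \<otimes> A [^] \<alpha>" using C_mult_cj[of A] by (simp add: cj_C_A)
  have "A [^] (\<alpha> * geom_sum \<alpha> n) \<otimes> C = C \<otimes> A [^] (\<alpha> * (\<alpha> * geom_sum \<alpha> n))"
    using C_mult_cj[of "A [^] (\<alpha> * geom_sum \<alpha> n)"] by (simp add: cj_int_pow cj_C_A int_pow_pow)
  then have "C [^] n \<otimes> A [^] (\<alpha> * geom_sum \<alpha> n) \<otimes> (C \<otimes> A [^] \<alpha>)
      = C [^] n \<otimes> C \<otimes> (A [^] (\<alpha> * (\<alpha> * geom_sum \<alpha> n)) \<otimes> A [^] \<alpha>)"
    by (metis A_closed C_closed int_pow_closed m_assoc m_closed nat_pow_closed)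
  moreover have "\<alpha> * (\<alpha> * geom_sum \<alpha> n) + \<alpha> = \<alpha> * geom_sum \<alpha> (Suc n)"
  proof -
    have "\<alpha> * geom_sum \<alpha> n + 1 = geom_sum \<alpha> (Suc n)" using geom_sum_telescope[of \<alpha> n] by (simp add: geom_sum_Suc algebra_simps)
    then show ?thesis by (metis distrib_left mult.right_neutral)
  qed
  ultimately show ?case using Suc by (simp add: AC flip: int_pow_mult)
qed simp

lemma cj_B_A_pow: "cj B (A [^] n) = C [^] n \<otimes> A [^] (\<alpha> * geom_sum \<alpha> n)" for n :: nat
  by (simp add: cj_nat_pow cj_B_A AC_pow)

lemma cj_C_pow_A: "cj (C [^] n) (A [^] i) = A [^] (i * \<alpha> ^ n)" for n :: nat and i :: int
  by (rule cj_by_nat_pow_power) (simp_all add: cj_C_A)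

lemma cj_A_C_pow: "cj A (C [^] n) = C [^] n \<otimes> A [^] (1 - \<alpha> ^ n)" for n :: nat
proof -
  have "C [^] n \<otimes> A [^] (\<alpha> ^ n) = A \<otimes> C [^] n"
    using mult_cj[of "C [^] n" A] cj_C_pow_A[of n 1] by simp
  then have "cj A (C [^] n) = inv A \<otimes> (A \<otimes> C [^] n \<otimes> inv (A [^] (\<alpha> ^ n))) \<otimes> A"
    unfolding cj_def by (metis A_closed C_closed int_pow_closed inv_solve_right m_closed nat_pow_closed)
  also have "\<dots> = C [^] n \<otimes> (inv (A [^] (\<alpha> ^ n)) \<otimes> A [^] (1::int))"
    by (simp add: m_assoc[symmetric])
  also have "inv (A [^] (\<alpha> ^ n)) \<otimes> A [^] (1::int) = A [^] (1 - \<alpha> ^ n)"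
    by (simp only: int_pow_neg[symmetric] int_pow_mult[symmetric] A_closed) simp
  finally show ?thesis .
qed

text \<open>Since \<open>C\<close> need not act invertibly on the cyclic group generated by \<open>A\<close>, we pass to the
  union \<open>R\<close> of its conjugates under negative powers of \<open>C\<close>, which is abelian and normalised by \<open>C\<close>.\<close>

definition R :: "'a set" where
  "R = {x \<in> carrier G. \<exists>(k::nat) (i::int). cj (C [^] k) x = A [^] i}"

lemma R_closed: "x \<in> R \<Longrightarrow> x \<in> carrier G" by (simp add: R_def)

lemma A_pow_in_R: "A [^] (i::int) \<in> R"
  unfolding R_def by (auto intro!: exI[of _ "0::nat"] exI[of _ i])

text \<open>Conjugation by \<open>C\<close> keeps powers of \<open>A\<close> among the powers of
  \<open>A\<close>, so every larger exponent of \<open>C\<close> works as well. This allows two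
  elements of \<open>R\<close> to be compared at one level.\<close>

lemma R_level:
  assumes "x \<in> R"
  shows "\<exists>k. \<forall>j\<ge>k. \<exists>i::int. cj (C [^] (j::nat)) x = A [^] i"
proof -
  from assms obtain k i where x: "x \<in> carrier G" "cj (C [^] (k::nat)) x = A [^] (i::int)"
    by (auto simp: R_def)
  have "\<exists>i::int. cj (C [^] j) x = A [^] i" if "k \<le> j" for j
  proof -
    have "C [^] j = C [^] k \<otimes> C [^] (j - k)" using that by (simp add: nat_pow_mult)
    then have "cj (C [^] j) x = A [^] (i * \<alpha> ^ (j - k))"
      using x by (simp add: cj_by_mult cj_C_pow_A)
    then show ?thesis by blast
  qed
  then show ?thesis by blast
qed

lemma R_common_level:
  assumes "x \<in> R" "y \<in> R"
  obtains k :: nat and i j :: int where "cj (C [^] k) x = A [^] i" "cj (C [^] k) y = A [^] j"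
proof -
  obtain k where k: "\<forall>j\<ge>k. \<exists>i::int. cj (C [^] (j::nat)) x = A [^] i" using R_level[OF assms(1)] by blast
  obtain l where l: "\<forall>j\<ge>l. \<exists>i::int. cj (C [^] (j::nat)) y = A [^] i" using R_level[OF assms(2)] by blast
  from k[rule_format, of "max k l"] l[rule_format, of "max k l"] show ?thesis using that by auto
qed

lemma R_mult:
  assumes "x \<in> R" "y \<in> R" shows "x \<otimes> y \<in> R"
proof -
  obtain k :: nat and i j :: int where "cj (C [^] k) x = A [^] i" "cj (C [^] k) y = A [^] j"
    by (rule R_common_level[OF assms])
  then have "cj (C [^] k) (x \<otimes> y) = A [^] (i + j)"
    using assms R_closed by (simp add: cj_mult int_pow_mult)
  then show ?thesis using assms R_closed unfolding R_def by blast
qed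

lemma R_inv: assumes "x \<in> R" shows "inv x \<in> R"
proof -
  from assms obtain k i where x: "x \<in> carrier G" "cj (C [^] (k::nat)) x = A [^] (i::int)"
    by (auto simp: R_def)
  then have "cj (C [^] k) (inv x) = A [^] (- i)" by (simp add: cj_inv int_pow_neg)
  then show ?thesis using x unfolding R_def by blast
qed

text \<open>Conjugation by one power of \<open>C\<close> is injective and carries both elements into
  the cyclic group of \<open>A\<close>.\<close>

lemma R_commute: assumes "x \<in> R" "y \<in> R" shows "cj x y = y"
proof -
  obtain k :: nat and i j :: int where k: "cj (C [^] k) x = A [^] i" "cj (C [^] k) y = A [^] j"
    by (rule R_common_level[OF assms])
  have c: "x \<in> carrier G" "y \<in> carrier G" using assms R_closed by auto
  have "cj (C [^] k) (x \<otimes> y) = cj (C [^] k) (y \<otimes> x)"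
    using c k by (simp add: cj_mult int_pow_mult[symmetric] add.commute)
  then have "x \<otimes> y = y \<otimes> x" by (rule cj_eqD[rotated 3]) (use c in auto)
  then show ?thesis using c by (simp add: cj_fixed_iff)
qed

text \<open>Conjugation by \<open>C [^] k\<close> commutes with conjugation by \<open>C\<close> and
  reduces the claim to the relation for \<open>A\<close>.\<close>

lemma cj_C_R: assumes "x \<in> R" shows "cj C x = x [^] \<alpha>"
proof -
  from assms obtain k i where x: "x \<in> carrier G" "cj (C [^] (k::nat)) x = A [^] (i::int)"
    by (auto simp: R_def)
  have "cj (C [^] k) (cj C x) = cj C (cj (C [^] k) x)"
    using x(1) by (simp add: cj_by_mult[symmetric] nat_pow_Suc2[symmetric] del: nat_pow_Suc)
  also have "\<dots> = cj (C [^] k) (x [^] \<alpha>)"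
    using x by (simp add: cj_int_pow cj_C_A int_pow_pow mult.commute)
  finally show ?thesis by (rule cj_eqD[rotated 3]) (use x in auto)
qed

lemma cj_inv_C_R: assumes "x \<in> R" shows "cj (inv C) x \<in> R"
proof -
  from assms obtain k i where x: "x \<in> carrier G" "cj (C [^] (k::nat)) x = A [^] (i::int)"
    by (auto simp: R_def)
  have "C [^] Suc k = C \<otimes> C [^] k" by (rule nat_pow_Suc2) simp
  then have "cj (C [^] Suc k) (cj (inv C) x) = A [^] i"
    using x by (simp add: cj_by_mult del: nat_pow_Suc)
  moreover have "cj (inv C) x \<in> carrier G" using x by simp
  ultimately show ?thesis unfolding R_def by blast
qed

lemma R_pow: assumes "x \<in> R" shows "x [^] (i::int) \<in> R"
proof -
  have "x [^] (n::nat) \<in> R" for n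
    by (induction n) (use assms A_pow_in_R[of 0] in \<open>simp_all add: R_mult\<close>)
  then show ?thesis unfolding int_pow_def2 using R_inv by presburger
qed

lemma cj_C_in_R: "x \<in> R \<Longrightarrow> cj C x \<in> R"
  by (simp add: cj_C_R R_pow)

lemma cj_C_int_pow_R: assumes "x \<in> R" shows "cj (C [^] (i::int)) x \<in> R"
proof -
  have "cj (C [^] (n::nat)) x \<in> R" for n
    by (induction n) (use assms R_closed in \<open>simp_all add: cj_by_mult cj_C_in_R\<close>)
  moreover have "cj (inv (C [^] (n::nat))) x \<in> R" for n
    unfolding nat_pow_inv[OF C_closed, symmetric]
    by (induction n) (use assms R_closed in \<open>simp_all add: cj_by_mult cj_inv_C_R\<close>)
  ultimately show ?thesis unfolding int_pow_def2 by presburger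
qed

section \<open>Cosets of \<open>R\<close> in the group generated by \<open>R\<close> and
  \<open>C\<close>\<close>

definition RC :: "int \<Rightarrow> 'a set" where
  "RC j = {x \<in> carrier G. x \<otimes> C [^] (- j) \<in> R}"

lemma RC_I: assumes "r \<in> R" shows "r \<otimes> C [^] j \<in> RC j"
  using assms R_closed by (simp add: RC_def m_assoc int_pow_mult[symmetric])

lemma RC_E:
  assumes "x \<in> RC j" obtains r where "r \<in> R" "x = r \<otimes> C [^] j"
proof
  show "x \<otimes> C [^] (- j) \<in> R" using assms by (simp add: RC_def)
  show "x = x \<otimes> C [^] (- j) \<otimes> C [^] j"
    using assms by (simp add: RC_def m_assoc int_pow_mult[symmetric])
qed

lemma RC_closed: "x \<in> RC j \<Longrightarrow> x \<in> carrier G" by (simp add: RC_def)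

text \<open>As \<open>C\<close> normalises \<open>R\<close>, the exponents of \<open>C\<close> add.
  They behave like a degree, which is ambiguous only if a power of \<open>C\<close> with nonzero
  exponent lies in \<open>R\<close>.\<close>

lemma RC_mult: assumes "x \<in> RC i" "y \<in> RC j" shows "x \<otimes> y \<in> RC (i + j)"
proof -
  obtain r where r: "r \<in> R" "x = r \<otimes> C [^] i" by (rule RC_E[OF assms(1)])
  obtain s where s: "s \<in> R" "y = s \<otimes> C [^] j" by (rule RC_E[OF assms(2)])
  note c = R_closed[OF r(1)] R_closed[OF s(1)]
  define s' where "s' = cj (C [^] (- i)) s"
  have s': "s' \<in> R" unfolding s'_def by (rule cj_C_int_pow_R[OF s(1)])
  have "cj (C [^] i) s' = s"
    using c unfolding s'_def by (simp add: cj_by_mult[symmetric] int_pow_mult[symmetric])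
  then have "C [^] i \<otimes> s = s' \<otimes> C [^] i" using mult_cj[of "C [^] i" s'] R_closed[OF s'] by simp
  then have "x \<otimes> y = (r \<otimes> s') \<otimes> (C [^] i \<otimes> C [^] j)"
    unfolding r s using c R_closed[OF s'] by (metis C_closed int_pow_closed m_assoc m_closed)
  then show ?thesis using RC_I[OF R_mult[OF r(1) s'], of "i + j"] by (simp add: int_pow_mult)
qed

lemma RC_inv: assumes "x \<in> RC i" shows "inv x \<in> RC (- i)"
proof -
  obtain r where r: "r \<in> R" "x = r \<otimes> C [^] i" by (rule RC_E[OF assms])
  have 1: "\<one> \<otimes> C [^] (- i) \<in> RC (- i)" by (rule RC_I) (use A_pow_in_R[of 0] in simp)
  have 2: "inv r \<otimes> C [^] (0::int) \<in> RC 0" by (rule RC_I[OF R_inv[OF r(1)]])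
  have "inv x = \<one> \<otimes> C [^] (- i) \<otimes> (inv r \<otimes> C [^] (0::int))"
    using R_closed[OF r(1)] unfolding r(2) by (simp add: inv_mult_group int_pow_neg)
  then show ?thesis using RC_mult[OF 1 2] by simp
qed

lemma RC_pow: assumes "x \<in> RC i" shows "x [^] (j::int) \<in> RC (i * j)"
proof -
  have 1: "\<one> \<in> RC 0" using RC_I[OF A_pow_in_R[of 0], of 0] by simp
  have n: "x [^] (n::nat) \<in> RC (i * int n)" for n
  proof (induction n)
    case (Suc n)
    show ?case using RC_mult[OF Suc assms] by (simp add: algebra_simps)
  qed (use 1 in simp)
  show ?thesis
  proof (cases j rule: int_cases2)
    case (nonneg m)
    then show ?thesis using n[of m] by (simp add: int_pow_int)
  next
    case (nonpos m)
    then show ?thesis using RC_inv[OF n[of m]] RC_closed[OF assms] by (simp add: int_pow_neg_int)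
  qed
qed

lemma RC_0: "x \<in> RC 0 \<longleftrightarrow> x \<in> R"
  using R_closed by (auto simp: RC_def)

lemma C_in_RC: "C \<in> RC 1"
  using RC_I[OF A_pow_in_R[of 0], of 1] by simp

lemma A_in_RC: "A \<in> RC 0"
  using A_pow_in_R[of 1] by (simp add: RC_0)

lemma RC_cj_C: "x \<in> RC i \<Longrightarrow> cj C x \<in> RC i" "x \<in> RC i \<Longrightarrow> cj (inv C) x \<in> RC i"
  unfolding cj_def using RC_mult[OF RC_mult[OF RC_inv[OF C_in_RC]] C_in_RC]
    RC_mult[OF RC_mult[OF C_in_RC] RC_inv[OF C_in_RC]] by auto

text \<open>Finiteness is forced here: two different degrees of one element put a power of
  \<open>C\<close> into the abelian group \<open>R\<close>.\<close>

lemma C_pow_in_R: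
  assumes "x \<in> RC i" "x \<in> RC j" shows "C [^] (i - j) \<in> R"
proof -
  have x: "x \<in> carrier G" using assms by (simp add: RC_def)
  have "inv (x \<otimes> C [^] (- i)) \<otimes> (x \<otimes> C [^] (- j)) \<in> R"
    using assms by (intro R_mult[OF R_inv]) (simp_all add: RC_def)
  moreover have "inv (x \<otimes> C [^] (- i)) \<otimes> (x \<otimes> C [^] (- j)) = C [^] i \<otimes> (inv x \<otimes> (x \<otimes> C [^] (- j)))"
    using x by (simp add: inv_mult_group int_pow_neg m_assoc)
  moreover have "\<dots> = C [^] (i - j)"
    using x by (simp add: m_assoc[symmetric] int_pow_mult[symmetric] flip: diff_conv_add_uminus)
  ultimately show ?thesis by simp
qed

section \<open>The commutator of \<open>A\<close> and \<open>B [^] \<beta>\<close>, computed in two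
  ways\<close>

definition E :: 'a where "E = inv A \<otimes> cj (B [^] \<beta>) A"

text \<open>Since \<open>B [^] \<beta> = C \<otimes> B \<otimes> inv C\<close>, conjugating
  \<open>A\<close> by it means conjugating by \<open>C\<close>, \<open>B\<close> and
  \<open>inv C\<close> in turn. Of these only \<open>B\<close> changes the degree: it turns
  \<open>A [^] \<alpha>\<close> into \<open>(A \<otimes> C) [^] \<alpha>\<close>.\<close>

lemma E_in_RC: "E \<in> RC \<alpha>"
proof -
  have "B [^] \<beta> = C \<otimes> B \<otimes> inv C" using cj_inv_C_B by (simp add: cj_def)
  then have "cj (B [^] \<beta>) A = cj (inv C) (cj B (cj C A))" by (simp add: cj_by_mult)
  also have "\<dots> = cj (inv C) ((A \<otimes> C) [^] \<alpha>)" by (simp add: cj_C_A cj_int_pow cj_B_A)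
  also have "\<dots> \<in> RC \<alpha>"
    using RC_pow[OF RC_mult[OF A_in_RC C_in_RC], of \<alpha>] by (intro RC_cj_C) simp
  finally show ?thesis unfolding E_def using RC_mult[OF RC_inv[OF A_in_RC]] by fastforce
qed

lemma E_eq: "E = cj A (B [^] (- \<beta>)) \<otimes> B [^] \<beta>"
  by (simp add: E_def cj_def m_assoc int_pow_neg)

text \<open>The factor \<open>C [^] (- \<beta>)\<close> cancels the degree of \<open>E\<close> in
  the mirrored cosets. So \<open>r\<close> lies in the mirror image of \<open>R\<close>, while its
  degree on this side is \<open>\<alpha> - \<beta>\<close>.\<close>

definition r where "r = E \<otimes> C [^] (- \<beta>)"

lemma r_in_RC: "r \<in> RC (\<alpha> - \<beta>)"
proof -
  have "C [^] (- \<beta>) \<in> RC (- \<beta>)" using RC_pow[OF C_in_RC, of "- \<beta>"] by simp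
  from RC_mult[OF E_in_RC this] show ?thesis by (simp add: r_def)
qed

lemma r_closed [simp]: "r \<in> carrier G" using RC_closed[OF r_in_RC] .

lemma r_in_swapped_R: "r \<in> macdonald.R G B (inv C)"
proof -
  interpret S: macdonald G B A "inv C" \<beta> \<alpha> by (rule swap)
  have B: "B \<in> S.RC 0" by (rule S.A_in_RC)
  have "cj A (B [^] (- \<beta>)) = (B \<otimes> inv C) [^] (- \<beta>)" by (simp add: cj_int_pow cj_A_B)
  moreover have "\<dots> \<in> S.RC (- \<beta>)"
    using S.RC_pow[OF S.RC_mult[OF B S.C_in_RC], of "- \<beta>"] by simp
  moreover have "B [^] \<beta> \<in> S.RC 0" using S.RC_pow[OF B, of \<beta>] by simp
  ultimately have "E \<in> S.RC (- \<beta> + 0)" unfolding E_eq by (metis S.RC_mult)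
  moreover have "inv C [^] \<beta> \<in> S.RC \<beta>" using S.RC_pow[OF S.C_in_RC, of \<beta>] by simp
  ultimately have "E \<otimes> inv C [^] \<beta> \<in> S.RC 0" using S.RC_mult by fastforce
  then show ?thesis by (simp add: r_def S.RC_0 int_pow_inv int_pow_neg)
qed

lemma cj_inv_C_r: "cj (inv C) r = r [^] \<beta>"
proof -
  interpret S: macdonald G B A "inv C" \<beta> \<alpha> by (rule swap)
  show ?thesis using S.cj_C_R[OF r_in_swapped_R] .
qed

lemma cj_B_r: "cj B r = r"
proof -
  interpret S: macdonald G B A "inv C" \<beta> \<alpha> by (rule swap)
  show ?thesis using S.R_commute[OF S.A_pow_in_R[of 1] r_in_swapped_R] by simp
qed

text \<open>Conjugation by \<open>inv C\<close> keeps the degree \<open>d\<close> of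
  \<open>r\<close>, but it also raises \<open>r\<close> to the power \<open>\<beta>\<close>, of
  degree \<open>d * \<beta>\<close>. Hence some \<open>C [^] n\<close> with positive
  \<open>n\<close> lies in \<open>R\<close> and centralises \<open>A\<close>, although it acts on
  \<open>A\<close> as the power \<open>\<alpha> ^ n\<close>, which is not 1.\<close>

lemma ord_A_pos_if_distinct:
  assumes "\<alpha> \<noteq> \<beta>" "\<beta> \<noteq> 1" "\<bar>\<alpha>\<bar> > 1"
  shows "0 < ord A"
proof -
  define d where "d = \<alpha> - \<beta>"
  have "cj (inv C) r \<in> RC d" by (rule RC_cj_C) (simp add: d_def r_in_RC)
  moreover have "r [^] \<beta> \<in> RC (d * \<beta>)" using RC_pow[OF r_in_RC] by (simp add: d_def)
  ultimately have CR: "C [^] (d - d * \<beta>) \<in> R" using C_pow_in_R by (simp add: cj_inv_C_r)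
  define n where "n = nat \<bar>d - d * \<beta>\<bar>"
  have "d * (1 - \<beta>) \<noteq> 0" using assms by (simp add: d_def)
  then have n0: "n \<noteq> 0" by (simp add: n_def algebra_simps)
  have "C [^] int n \<in> R"
    using CR R_inv[OF CR] int_pow_neg[OF C_closed, of "d - d * \<beta>"] by (auto simp: n_def abs_if)
  then have "C [^] n \<in> R" by (simp add: int_pow_int)
  then have "cj (C [^] n) A = A" using R_commute[OF _ A_pow_in_R[of 1]] by simp
  then have "A [^] (\<alpha> ^ n) = A [^] (1::int)" using cj_C_pow_A[of n 1] by simp
  then have "int (ord A) dvd \<alpha> ^ n - 1" by (simp only: int_pow_eq_iff_dvd A_closed)
  moreover have "\<alpha> ^ n \<noteq> 1"
  proof
    assume "\<alpha> ^ n = 1"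
    then have "\<bar>\<alpha>\<bar> ^ n = 1" by (metis abs_1 power_abs)
    then show False using assms(3) n0 one_less_power[of "\<bar>\<alpha>\<bar>" n] by simp
  qed
  ultimately show ?thesis by (metis dvd_0_left eq_iff_diff_eq_0 gr0I of_nat_0)
qed


section \<open>The case of equal exponents\<close>

lemma fixed_by_C:
  assumes "x \<in> carrier G" "cj A x = x" "cj B x = x"
  shows "cj C x = x"
proof -
  have C: "C = inv A \<otimes> cj B A" by (simp add: cj_B_A m_assoc[symmetric])
  have "cj (cj B A) x = cj B (cj A (cj (inv B) x))"
    using assms(1) by (simp add: cj_def[of B A] cj_by_mult)
  moreover have "cj (inv A) x = x" "cj (inv B) x = x"
    using assms cj_by_inv_cancel(1)[of A x] cj_by_inv_cancel(1)[of B x] by auto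
  ultimately show ?thesis using assms unfolding C by (simp add: cj_by_mult)
qed

text \<open>For equal exponents \<open>s\<close> is the mirror image of \<open>r\<close>. Collecting
  gives a power of \<open>A\<close>, for negative \<open>\<alpha>\<close> only up to conjugation by
  a power of \<open>C\<close>, which fixes \<open>s\<close>. The residues modulo 4 keep the exponent
  from vanishing.\<close>

lemma twisted_power_eq:
  assumes "\<alpha> mod 4 = 3" and s: "s = (A \<otimes> C) [^] (- \<alpha>) \<otimes> A [^] \<alpha> \<otimes> C [^] \<alpha>" and "cj C s = s"
  shows "\<exists>g::int. g \<noteq> 0 \<and> s = A [^] g"
proof (cases \<alpha> rule: int_cases2)
  case (nonneg n)
  have "odd n" using assms(1) unfolding nonneg by presburger
  have "s = inv (C [^] n \<otimes> A [^] (\<alpha> * geom_sum \<alpha> n)) \<otimes> A [^] \<alpha> \<otimes> C [^] n"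
    unfolding s using AC_pow[of n] by (simp add: nonneg int_pow_neg int_pow_int)
  also have "\<dots> = inv (A [^] (\<alpha> * geom_sum \<alpha> n)) \<otimes> cj (C [^] n) (A [^] \<alpha>)"
    by (simp add: inv_mult_group m_assoc cj_def)
  also have "\<dots> = A [^] (- (\<alpha> * geom_sum \<alpha> n) + \<alpha> * \<alpha> ^ n)"
    by (simp only: cj_C_pow_A int_pow_mult int_pow_neg A_closed)
  finally have "s = A [^] (\<alpha> * (\<alpha> ^ n - geom_sum \<alpha> n))" by (simp add: algebra_simps)
  moreover have "\<alpha> * (\<alpha> ^ n - geom_sum \<alpha> n) \<noteq> 0"
    using geom_sum_mod_4[OF assms(1) \<open>odd n\<close>] power_mod_4[OF assms(1) \<open>odd n\<close>] assms(1) by auto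
  ultimately show ?thesis by blast
next
  case (nonpos n)
  have "odd n" using assms(1) unfolding nonpos by presburger
  have sc: "s \<in> carrier G" by (simp add: s)
  have "s = C [^] n \<otimes> A [^] (\<alpha> * geom_sum \<alpha> n) \<otimes> A [^] \<alpha> \<otimes> inv (C [^] n)"
    unfolding s using AC_pow[of n] by (simp add: nonpos int_pow_neg int_pow_int)
  also have "\<dots> = cj (inv (C [^] n)) (A [^] (\<alpha> * geom_sum \<alpha> n + \<alpha>))"
    by (simp add: m_assoc cj_def int_pow_mult)
  finally have "cj (C [^] n) s = A [^] (\<alpha> * (geom_sum \<alpha> n + 1))" by (simp add: algebra_simps)
  moreover have "cj (C [^] n) s = s"
    using cj_by_pow_fixed[OF C_closed sc assms(3), of "int n"] by (simp add: int_pow_int)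
  moreover have "geom_sum \<alpha> n \<noteq> - 1" using geom_sum_mod_4[OF assms(1) \<open>odd n\<close>] by (intro notI) simp
  then have "\<alpha> * (geom_sum \<alpha> n + 1) \<noteq> 0" using assms(1) by auto
  ultimately show ?thesis by metis
qed

text \<open>Now \<open>r\<close> lies in \<open>R\<close> and in its mirror image, so it commutes
  with \<open>A\<close>, \<open>B\<close> and hence \<open>C\<close>. But \<open>r\<close> is a
  power \<open>B [^] g\<close> with nonzero \<open>g\<close>, and \<open>inv C\<close> raises it to
  the power \<open>\<beta>\<close>; so \<open>B [^] (g * (\<beta> - 1))\<close> is trivial.\<close>

lemma ord_B_pos_if_equal:
  assumes "\<alpha> = \<beta>" "\<beta> \<noteq> 1" "\<beta> mod 4 = 3"
  shows "0 < ord B"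
proof -
  interpret S: macdonald G B A "inv C" \<beta> \<alpha> by (rule swap)
  have "r \<in> R" using r_in_RC assms(1) by (simp add: RC_0)
  then have "cj A r = r" using R_commute[OF A_pow_in_R[of 1]] by simp
  then have "cj C r = r" using cj_B_r by (intro fixed_by_C) simp_all
  then have fixed: "cj (inv C) r = r" using cj_by_inv_cancel(1)[of C r] by simp
  have "r = (B \<otimes> inv C) [^] (- \<beta>) \<otimes> B [^] \<beta> \<otimes> inv C [^] \<beta>"
    unfolding r_def E_eq cj_int_pow[OF A_closed B_closed] cj_A_B
    by (simp only: int_pow_inv int_pow_neg C_closed)
  from S.twisted_power_eq[OF assms(3) this fixed]
  obtain g :: int where g: "g \<noteq> 0" "r = B [^] g" by blast
  have "B [^] (g * \<beta>) = B [^] g"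
    using cj_inv_C_r fixed g(2) by (simp add: int_pow_pow)
  then have "int (ord B) dvd g * \<beta> - g" by (simp add: int_pow_eq_iff_dvd)
  moreover have "g * \<beta> - g \<noteq> 0" using g(1) assms(2) by simp
  ultimately show ?thesis by (metis dvd_0_left gr0I of_nat_0)
qed

text \<open>For \<open>n = ord A\<close>, conjugating \<open>A [^] n = \<one>\<close> by
  \<open>B\<close> shows that \<open>C [^] n\<close> is a power of \<open>A\<close>.\<close>

lemma ord_C_pos: assumes "0 < ord A" shows "0 < ord C"
proof -
  have "\<one> = C [^] ord A \<otimes> A [^] (\<alpha> * geom_sum \<alpha> (ord A))" using cj_B_A_pow[of "ord A"] by simp
  then have "C [^] ord A = A [^] (- (\<alpha> * geom_sum \<alpha> (ord A)))"
    using inv_equality[of "C [^] ord A" "A [^] (\<alpha> * geom_sum \<alpha> (ord A))"] by (simp add: int_pow_neg)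
  then have "C [^] int (ord A * ord A) = (A [^] (- (\<alpha> * geom_sum \<alpha> (ord A)))) [^] int (ord A)"
    by (simp only: int_pow_int nat_pow_pow[symmetric] C_closed)
  also have "\<dots> = \<one>" by (simp add: int_pow_pow int_pow_eq_one_iff)
  finally show ?thesis using assms ord_pos_iff[OF C_closed] by (metis mult_eq_0_iff not_gr0 of_nat_eq_0_iff)
qed

lemma cj_C_trivial_dvd: assumes "C [^] (n::nat) = \<one>" shows "int (ord A) dvd \<alpha> ^ n - 1"
proof -
  have "A [^] (\<alpha> ^ n) = A [^] (1::int)" using cj_C_pow_A[of n 1] assms by simp
  then show ?thesis by (simp only: int_pow_eq_iff_dvd A_closed)
qed

text \<open>By the mirror image of \<open>ord_C_pos\<close> the order of \<open>C\<close> is finite,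
  so \<open>ord A\<close> divides some \<open>\<alpha> ^ n - 1\<close>. If this number is 0, then
  \<open>\<alpha> = - 1\<close>, the geometric sum vanishes, and \<open>A [^] n\<close> is conjugate
  to \<open>C [^] n = \<one>\<close>.\<close>

lemma ord_A_pos_if_ord_B_pos: assumes "0 < ord B" "\<alpha> \<noteq> 1" "odd \<alpha>" shows "0 < ord A"
proof -
  interpret S: macdonald G B A "inv C" \<beta> \<alpha> by (rule swap)
  define n where "n = 2 * ord C"
  have n0: "n \<noteq> 0" using S.ord_C_pos[OF assms(1)] by (simp add: n_def)
  have Cn: "C [^] n = \<one>" by (simp add: n_def pow_eq_id)
  show ?thesis
  proof (cases "\<alpha> ^ n = 1")
    case False
    then show ?thesis using cj_C_trivial_dvd[OF Cn] by (metis dvd_0_left eq_iff_diff_eq_0 gr0I of_nat_0)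
  next
    case True
    then have "\<bar>\<alpha>\<bar> ^ n = 1" by (metis abs_1 power_abs)
    moreover have "\<bar>\<alpha>\<bar> \<le> 1"
    proof (rule ccontr)
      assume "\<not> \<bar>\<alpha>\<bar> \<le> 1"
      then show False using one_less_power[of "\<bar>\<alpha>\<bar>" n] n0 \<open>\<bar>\<alpha>\<bar> ^ n = 1\<close> by simp
    qed
    ultimately have "\<alpha> = - 1" using assms(2,3) by presburger
    then have "geom_sum \<alpha> n = 0" using geom_sum_telescope[of \<alpha> n] True by simp
    then have "cj B (A [^] n) = \<one>" using cj_B_A_pow[of n] Cn by simp
    then have "A [^] n = \<one>" using cj_eqD[of B "A [^] n" \<one>] by simp
    then show ?thesis using n0 by (metis A_closed dvd_0_left gr0I pow_eq_id)
  qed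
qed

lemma finite_orders:
  assumes "\<alpha> \<noteq> 1" "\<beta> \<noteq> 1" "\<alpha> mod 4 = 3" "\<beta> mod 4 = 3"
  shows "0 < ord A" "0 < ord B" "0 < ord C"
proof -
  interpret S: macdonald G B A "inv C" \<beta> \<alpha> by (rule swap)
  have o: "odd \<alpha>" "odd \<beta>" using assms by presburger+
  have "0 < ord A \<or> 0 < ord B"
  proof (cases "\<alpha> = \<beta>")
    case True
    then show ?thesis using ord_B_pos_if_equal[OF True assms(2,4)] by simp
  next
    case False
    \<comment> \<open>The only integer of absolute value at most 1 that is 3 modulo 4 is -1, and
      distinct exponents cannot both equal it.\<close>
    have "\<bar>\<alpha>\<bar> > 1 \<or> \<bar>\<beta>\<bar> > 1" using False assms by (cases "\<alpha> = - 1"; cases "\<beta> = - 1") presburger+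
    then show ?thesis using ord_A_pos_if_distinct[OF False assms(2)] S.ord_A_pos_if_distinct[OF False[symmetric] assms(1)] by auto
  qed
  then show "0 < ord A" "0 < ord B"
    using ord_A_pos_if_ord_B_pos[OF _ assms(1) o(1)] S.ord_A_pos_if_ord_B_pos[OF _ assms(2) o(2)] by auto
  then show "0 < ord C" using ord_C_pos by simp
qed

end

section \<open>Prime divisors of the orders\<close>

context macdonald
begin

lemma cj_B_C_pow: "cj B (C [^] n) = B [^] (\<beta> ^ n - 1) \<otimes> C [^] n" for n :: nat
proof -
  interpret S: macdonald G B A "inv C" \<beta> \<alpha> by (rule swap)
  have "inv (cj B (inv C [^] n)) = inv (inv C [^] n \<otimes> B [^] (1 - \<beta> ^ n))"
    by (simp only: S.cj_A_C_pow)
  moreover have "inv (cj B (inv C [^] n)) = cj B (C [^] n)"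
    by (simp add: cj_inv nat_pow_inv)
  moreover have "inv (inv C [^] n \<otimes> B [^] (1 - \<beta> ^ n)) = B [^] (- (1 - \<beta> ^ n)) \<otimes> C [^] n"
    unfolding int_pow_neg[OF B_closed] by (simp add: inv_mult_group nat_pow_inv)
  ultimately show ?thesis by simp
qed

text \<open>The exponents \<open>\<alpha> * geom_sum \<alpha> n\<close> and
  \<open>1 - \<alpha> ^ n\<close> are both multiples of the geometric sum.\<close>

lemma A_pow_trivial:
  assumes "int (ord A) dvd geom_sum \<alpha> n"
  shows "cj B (A [^] n) = C [^] n" "cj A (C [^] n) = C [^] n"
proof -
  have "int (ord A) dvd \<alpha> * geom_sum \<alpha> n" using assms by simp
  then have "A [^] (\<alpha> * geom_sum \<alpha> n) = \<one>" by (simp only: int_pow_eq_one_iff A_closed)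
  then show "cj B (A [^] n) = C [^] n" by (simp add: cj_B_A_pow)
  have "1 - \<alpha> ^ n = geom_sum \<alpha> n * (1 - \<alpha>)" using geom_sum_telescope[of \<alpha> n] by (simp add: algebra_simps)
  then have "A [^] (1 - \<alpha> ^ n) = \<one>" using assms by (simp only: int_pow_eq_one_iff A_closed dvd_mult2)
  then show "cj A (C [^] n) = C [^] n" by (simp add: cj_A_C_pow)
qed

text \<open>With \<open>lcm (ord A) (ord C) = n p\<close> the conjugate of \<open>A\<^sup>n\<close> by \<open>B\<close> is \<open>C\<^sup>n\<close>, and it differs
  from \<open>A\<^sup>n\<close> by a power of \<open>B\<close> commuting with \<open>C\<close>. So \<open>C\<close> centralises \<open>A\<^sup>n\<close>,
  which forces \<open>A\<^sup>n = C\<^sup>n = 1\<close>.\<close>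

lemma no_largest_bad_prime:
  fixes p :: nat
  assumes pos: "0 < ord A" "0 < ord B" "0 < ord C"
    and p: "prime p" "odd p" "p dvd ord A" "\<not> int p dvd \<alpha> - 1"
    and pp: "int p dvd \<beta> - 1 \<or> (\<forall>f. p ^ f dvd ord B \<longrightarrow> p ^ f dvd ord A)"
    and largeA: "\<And>q. prime q \<Longrightarrow> q dvd ord A \<Longrightarrow> int q dvd \<alpha> - 1 \<or> q \<le> p"
    and largeB: "\<And>q. prime q \<Longrightarrow> q dvd ord B \<Longrightarrow> int q dvd \<beta> - 1 \<or> q \<le> p"
  shows False
proof -
  interpret S: macdonald G B A "inv C" \<beta> \<alpha> by (rule swap)
  define k where "k = lcm (ord A) (ord C)"
  have k0: "0 < k" using pos by (simp add: k_def lcm_pos_nat)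
  have "p dvd k" using p(3) unfolding k_def by auto
  then obtain n where kn: "k = n * p" by (metis dvd_def mult.commute)
  have n0: "0 < n" using k0 kn by (cases n) auto
  have Ck: "C [^] k = \<one>" by (simp add: pow_eq_id k_def)
  have ak: "int (ord A) dvd \<alpha> ^ (n * p) - 1" using cj_C_trivial_dvd[OF Ck] by (simp add: kn)
  have bk: "int (ord B) dvd \<beta> ^ (n * p) - 1" using S.cj_C_trivial_dvd[of k] Ck by (simp add: kn nat_pow_inv)
  have "ord A dvd n * p" unfolding kn[symmetric] k_def by simp
  then have "int (ord A) dvd geom_sum \<alpha> n"
    using dvd_geom_sum_if_largest_bad_prime[OF p(1,4) n0 pos(1) _ ak largeA] by blast
  then have AC: "cj B (A [^] n) = C [^] n" by (rule A_pow_trivial)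
  have "\<forall>f. p ^ f dvd ord A \<longrightarrow> p ^ f dvd n * p"
    using \<open>ord A dvd n * p\<close> dvd_trans by blast
  then have b: "int (ord B) dvd (\<beta> ^ n - 1) * (\<beta> - 1)"
    using pp by (intro dvd_mult_if_largest_bad_prime[OF p(1,2) n0 pos(2) bk largeB]) auto
  define z where "z = B [^] (\<beta> ^ n - 1)"
  have zc: "z \<in> carrier G" by (simp add: z_def)
  have "cj (inv C) z = B [^] (\<beta> * (\<beta> ^ n - 1))"
    by (simp add: z_def cj_int_pow cj_inv_C_B int_pow_pow)
  also have "\<dots> = z" unfolding z_def int_pow_eq_iff_dvd[OF B_closed] using b by (simp add: algebra_simps)
  finally have zC: "cj C z = z" using cj_by_inv_cancel(2)[of C z] zc by simp
  have zB: "cj B z = z" unfolding z_def using cj_pow_self[of B 1] by simp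
  \<comment> \<open>Both sides equal \<open>z \<otimes> C [^] n\<close>. Cancelling the conjugation
    expresses \<open>C [^] n\<close> through \<open>A [^] n\<close> and an element commuting with
    \<open>C\<close>.\<close>
  have "cj B (C [^] n) = cj B (z \<otimes> A [^] n)"
    using zc zB AC by (simp add: cj_mult cj_B_C_pow z_def)
  then have D: "C [^] n = z \<otimes> A [^] n" by (rule cj_eqD[rotated 3]) (simp_all add: zc)
  have "cj C (C [^] n) = C [^] n" using cj_pow_self[of C 1 "int n"] by (simp add: int_pow_int)
  then have "z \<otimes> cj C (A [^] n) = z \<otimes> A [^] n" unfolding D using zc zC by (simp add: cj_mult)
  then have "cj C (A [^] n) = A [^] n" using zc by simp
  then have "A [^] (\<alpha> * int n) = A [^] int n" by (simp add: cj_int_pow cj_C_A int_pow_pow flip: int_pow_int)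
  then have "int (ord A) dvd (\<alpha> - 1) * int n" by (simp add: int_pow_eq_iff_dvd algebra_simps)
  moreover have "int (ord A) dvd int p * int n"
    using \<open>ord A dvd n * p\<close> by (metis int_dvd_int_iff mult.commute of_nat_mult)
  \<comment> \<open>As \<open>p\<close> is prime to \<open>\<alpha> - 1\<close>, the two multiples
    of \<open>ord A\<close> have greatest common divisor \<open>n\<close>.\<close>
  ultimately have "int (ord A) dvd gcd ((\<alpha> - 1) * int n) (int p * int n)" by simp
  also have "gcd ((\<alpha> - 1) * int n) (int p * int n) = int n"
  proof -
    have "gcd (int p) (\<alpha> - 1) = 1" using p by (simp add: prime_imp_coprime coprime_imp_gcd_eq_1)
    then show ?thesis by (simp add: gcd_mult_right gcd_mult_left)
  qed
  finally have an: "ord A dvd n" by simp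
  then have "A [^] n = \<one>" by (simp add: pow_eq_id)
  then have "ord C dvd n" using AC by (simp add: pow_eq_id[symmetric])
  \<comment> \<open>Now \<open>n\<close> is a common multiple of \<open>ord A\<close> and
    \<open>ord C\<close>, although their least common multiple is \<open>n * p\<close>.\<close>
  then have "n * p dvd n" using an unfolding kn[symmetric] k_def by simp
  then show False using n0 prime_gt_1_nat[OF p(1)] by (auto dest: dvd_imp_le)
qed

section \<open>Excluding primes that divide an order but not the exponent minus one\<close>

definition bad :: "nat \<Rightarrow> bool" where
  "bad q \<longleftrightarrow> prime q \<and> (q dvd ord A \<and> \<not> int q dvd \<alpha> - 1 \<or> q dvd ord B \<and> \<not> int q dvd \<beta> - 1)"

lemma bad_swap: "macdonald.bad G B A \<beta> \<alpha> q \<longleftrightarrow> bad q"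
proof -
  interpret S: macdonald G B A "inv C" \<beta> \<alpha> by (rule swap)
  show ?thesis unfolding bad_def S.bad_def by blast
qed

text \<open>If \<open>p\<close> is bad for both generators, the argument starts from the one whose
  order has the larger power of \<open>p\<close>, as the condition \<open>pp\<close> of
  \<open>no_largest_bad_prime\<close> demands; otherwise from the one for which \<open>p\<close> is
  bad.\<close>

lemma no_largest_bad_prime_A:
  assumes pos: "0 < ord A" "0 < ord B" "0 < ord C" and odd: "odd \<alpha>"
    and p: "prime p" "p dvd ord A" "\<not> int p dvd \<alpha> - 1" and large: "\<And>q. bad q \<Longrightarrow> q \<le> p"
  shows False
proof -
  interpret S: macdonald G B A "inv C" \<beta> \<alpha> by (rule swap)
  have lA: "int q dvd \<alpha> - 1 \<or> q \<le> p" if "prime q" "q dvd ord A" for q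
    using that large[of q] by (auto simp: bad_def)
  have lB: "int q dvd \<beta> - 1 \<or> q \<le> p" if "prime q" "q dvd ord B" for q
    using that large[of q] by (auto simp: bad_def)
  have p2: "odd p"
  proof (rule ccontr)
    assume "\<not> odd p"
    then have "p = 2" using p(1) primes_dvd_imp_eq two_is_prime_nat by blast
    then show False using p(3) odd by simp
  qed
  show False
  proof (cases "int p dvd \<beta> - 1 \<or> (\<forall>f. p ^ f dvd ord B \<longrightarrow> p ^ f dvd ord A)")
    case True
    show False by (rule no_largest_bad_prime[OF pos p(1) p2 p(2,3) True lA lB])
  next
    case False
    then obtain f where f: "\<not> int p dvd \<beta> - 1" "p ^ f dvd ord B" "\<not> p ^ f dvd ord A" by blast
    have "p ^ g dvd ord B" if "p ^ g dvd ord A" for g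
    proof -
      have "g \<le> f" using f(3) that by (meson dvd_trans le_imp_power_dvd nle_le)
      then show ?thesis using f(2) by (meson dvd_trans le_imp_power_dvd)
    qed
    then have pp: "int p dvd \<alpha> - 1 \<or> (\<forall>g. p ^ g dvd ord A \<longrightarrow> p ^ g dvd ord B)" by blast
    have "f \<noteq> 0" using f(3) by (intro notI) simp
    then have "p dvd ord B" using f(2) by (meson dvd_power dvd_trans gr0I)
    moreover have "0 < ord (inv C)" using pos(3) by simp
    ultimately show False
      using S.no_largest_bad_prime[OF pos(2,1) _ p(1) p2 _ f(1) pp lB lA] by blast
  qed
qed

lemma prime_divisors_of_orders:
  assumes pos: "0 < ord A" "0 < ord B" "0 < ord C" and odd: "odd \<alpha>" "odd \<beta>"
  shows "\<not> bad q"
proof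
  interpret S: macdonald G B A "inv C" \<beta> \<alpha> by (rule swap)
  assume "bad q"
  have "{q. bad q} \<subseteq> {..max (ord A) (ord B)}"
    using pos by (auto simp: bad_def le_max_iff_disj dest: dvd_imp_le)
  then have fin: "finite {q. bad q}" by (rule finite_subset) simp
  define p where "p = Max {q. bad q}"
  have "bad p" using Max_in[OF fin] \<open>bad q\<close> unfolding p_def by blast
  have large: "\<And>q. bad q \<Longrightarrow> q \<le> p" using Max_ge[OF fin] unfolding p_def by blast
  have p: "prime p" using \<open>bad p\<close> by (simp add: bad_def)
  have pos': "0 < ord (inv C)" using pos(3) by simp
  show False
  proof (cases "p dvd ord A \<and> \<not> int p dvd \<alpha> - 1")
    case True
    then show False using no_largest_bad_prime_A[OF pos odd(1) p] large by blast
  next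
    case False
    then have "p dvd ord B" "\<not> int p dvd \<beta> - 1" using \<open>bad p\<close> by (auto simp: bad_def)
    then show False
      using S.no_largest_bad_prime_A[OF pos(2,1) pos' odd(2) p] large bad_swap by blast
  qed
qed

end

section \<open>The 2-parts of the orders\<close>

locale good_macdonald = macdonald +
  assumes ord_A_pos: "0 < ord A" and ord_B_pos: "0 < ord B" and ord_C_pos': "0 < ord C"
    and prime_dvd_ord_A: "\<And>q. prime q \<Longrightarrow> q dvd ord A \<Longrightarrow> int q dvd \<alpha> - 1"
    and prime_dvd_ord_B: "\<And>q. prime q \<Longrightarrow> q dvd ord B \<Longrightarrow> int q dvd \<beta> - 1"
    and \<alpha>_mod_4: "\<alpha> mod 4 = 3" and \<beta>_mod_4: "\<beta> mod 4 = 3"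
begin

lemma good_swap: "good_macdonald G B A (inv C) \<beta> \<alpha>"
proof -
  interpret S: macdonald G B A "inv C" \<beta> \<alpha> by (rule swap)
  show ?thesis
    by unfold_locales
      (simp_all add: ord_A_pos ord_B_pos ord_C_pos' prime_dvd_ord_A prime_dvd_ord_B \<alpha>_mod_4 \<beta>_mod_4)
qed

lemma gcd_dvd_geom_sum: "int (gcd (ord A) n) dvd geom_sum \<alpha> n"
  using ord_A_pos by (intro dvd_geom_sum prime_dvd_ord_A) (auto intro: dvd_trans)

text \<open>For \<open>h = 2 * g\<close> the sum is
  \<open>(1 + \<alpha>) * geom_sum (\<alpha> ^ 2) g\<close>. The second factor is a multiple of
  \<open>gcd d g\<close>, the first of 4, and \<open>d\<close> divides
  \<open>4 * gcd d g\<close>.\<close>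

lemma ord_A_dvd_double_geom_sum:
  assumes "even h" "d dvd ord A" "d dvd 2 * h"
  shows "int d dvd geom_sum \<alpha> h"
proof -
  obtain g where h: "h = 2 * g" using assms(1) by (elim evenE)
  have d0: "0 < d" using assms(2) ord_A_pos by (auto intro: Nat.gr0I)
  have "d dvd 4 * d" "d dvd 4 * g" using assms(3) h by simp_all
  then have "d dvd gcd (4 * d) (4 * g)" by (rule gcd_greatest)
  then have "d dvd 4 * gcd d g" by (simp add: gcd_mult_distrib_nat)
  then have "int d dvd 4 * int (gcd d g)" by (metis int_dvd_int_iff of_nat_mult of_nat_numeral)
  moreover have "int (gcd d g) dvd geom_sum (\<alpha> ^ 2) g"
  proof (rule dvd_geom_sum)
    fix q assume "prime q" "q dvd gcd d g"
    then have "int q dvd \<alpha> - 1" using assms(2) by (intro prime_dvd_ord_A) (auto intro: dvd_trans)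
    then show "int q dvd \<alpha> ^ 2 - 1" using geom_sum_telescope[of \<alpha> 2] by (metis dvd_mult2)
  qed (use d0 in auto)
  moreover have "4 dvd 1 + \<alpha>" using \<alpha>_mod_4 by presburger
  ultimately have "int d dvd (1 + \<alpha>) * geom_sum (\<alpha> ^ 2) g" by (meson dvd_trans mult_dvd_mono)
  moreover have "geom_sum \<alpha> h = (1 + \<alpha>) * geom_sum (\<alpha> ^ 2) g"
    unfolding h geom_sum_mult by (simp add: geom_sum_def eval_nat_numeral)
  ultimately show ?thesis by simp
qed

text \<open>Both geometric sums of length \<open>n\<close> vanish modulo the orders. So
  \<open>B\<close> conjugates \<open>A [^] n\<close> to \<open>C [^] n\<close>, and \<open>A\<close>
  conjugates \<open>B [^] n\<close> to its inverse, while both generators fix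
  \<open>C [^] n\<close>.\<close>

lemma half_powers_equal:
  assumes "even n" "ord A dvd 2 * n" "ord B dvd 2 * n"
  shows "A [^] n = C [^] n" "B [^] n = C [^] n" "cj A (C [^] n) = C [^] n" "cj B (C [^] n) = C [^] n"
    "C [^] n \<otimes> C [^] n = \<one>"
proof -
  interpret S: good_macdonald G B A "inv C" \<beta> \<alpha> by (rule good_swap)
  have 1: "cj B (A [^] n) = C [^] n" "cj A (C [^] n) = C [^] n"
    using A_pow_trivial[OF ord_A_dvd_double_geom_sum[OF assms(1) dvd_refl assms(2)]] by auto
  have 2: "cj A (B [^] n) = inv (C [^] n)" "cj B (inv (C [^] n)) = inv (C [^] n)"
    using S.A_pow_trivial[OF S.ord_A_dvd_double_geom_sum[OF assms(1) dvd_refl assms(3)]]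
    by (auto simp: nat_pow_inv)
  show 3: "cj A (C [^] n) = C [^] n" using 1 by simp
  show 4: "cj B (C [^] n) = C [^] n" using 2(2) by (metis B_closed C_closed cj_closed cj_inv inv_inv nat_pow_closed)
  show A: "A [^] n = C [^] n" by (rule cj_eqD[of B]) (simp_all add: 1 4)
  have B: "B [^] n = inv (C [^] n)" by (rule cj_eqD[of A]) (simp_all add: 2 3 cj_inv)
  have "A [^] n \<otimes> A [^] n = \<one>" using assms(2) by (simp add: nat_pow_mult pow_eq_id mult_2)
  then show C: "C [^] n \<otimes> C [^] n = \<one>" by (simp add: A)
  then have "inv (C [^] n) = C [^] n" by (simp add: inv_equality)
  then show "B [^] n = C [^] n" using B by simp
qed

lemma ord_dvd_descent:
  assumes "even h" "ord A dvd 4 * h" "ord B dvd 4 * h"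
  shows "ord A dvd 2 * h"
proof -
  define n where "n = 2 * h"
  have n: "even n" "ord A dvd 2 * n" "ord B dvd 2 * n" using assms by (simp_all add: n_def)
  note eqs = half_powers_equal[OF n]
  define s where "s = \<alpha> * geom_sum \<alpha> h"
  \<comment> \<open>By Bezout this makes \<open>s\<close> a multiple of \<open>n\<close> modulo
    \<open>ord A\<close>.\<close>
  have "int (gcd (ord A) n) dvd s"
    unfolding s_def n_def using ord_A_dvd_double_geom_sum[OF assms(1), of "gcd (ord A) (2 * h)"] by simp
  then obtain t where "s = gcd (int (ord A)) (int n) * t" by (auto elim: dvdE)
  moreover obtain u' v' where "u' * int (ord A) + v' * int n = gcd (int (ord A)) (int n)"
    using bezout_int[of "int (ord A)" "int n"] by blast
  ultimately have "s = (t * u') * int (ord A) + (t * v') * int n" by (metis distrib_left mult.assoc mult.commute)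
  then obtain u v where uv: "s = u * int (ord A) + v * int n" by blast
  have w: "A [^] s = (C [^] n) [^] v"
  proof -
    have "A [^] s = A [^] (v * int n)" by (simp add: int_pow_eq_iff_dvd uv)
    also have "\<dots> = (A [^] n) [^] v" by (simp add: int_pow_pow mult.commute flip: int_pow_int)
    finally show ?thesis by (simp add: eqs(1))
  qed
  have wB: "cj B (A [^] s) = A [^] s" by (simp add: w cj_int_pow eqs(4))
  have Ch: "cj B (C [^] h) = C [^] h"
  proof -
    interpret S: good_macdonald G B A "inv C" \<beta> \<alpha> by (rule good_swap)
    \<comment> \<open>The order of \<open>B\<close> divides \<open>2 * d\<close>, while
      \<open>d\<close> divides the geometric sum; the missing 2 comes from
      \<open>\<beta> - 1\<close>.\<close>
    define d where "d = gcd (ord B) (2 * h)"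
    have "int d dvd geom_sum \<beta> h" using S.ord_A_dvd_double_geom_sum[OF assms(1), of d] by (simp add: d_def)
    moreover have "ord B dvd gcd (2 * ord B) (2 * (2 * h))" using assms(3) by simp
    then have "ord B dvd 2 * d" unfolding d_def by (simp only: gcd_mult_distrib_nat)
    then have "int (ord B) dvd 2 * int d" by (metis int_dvd_int_iff of_nat_mult of_nat_numeral)
    moreover have "2 dvd \<beta> - 1" using \<beta>_mod_4 by presburger
    ultimately have "int (ord B) dvd (\<beta> - 1) * geom_sum \<beta> h" by (meson dvd_trans mult_dvd_mono)
    then have "B [^] (\<beta> ^ h - 1) = \<one>" by (simp only: geom_sum_telescope int_pow_eq_one_iff B_closed)
    then show ?thesis by (simp add: cj_B_C_pow)
  qed
  have "cj B (A [^] h) = cj B (C [^] h \<otimes> A [^] s)"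
    using wB by (simp add: cj_B_A_pow cj_mult Ch s_def)
  then have "A [^] h = C [^] h \<otimes> A [^] s" by (rule cj_eqD[rotated 3]) simp_all
  moreover have "cj C (C [^] h) = C [^] h" using cj_pow_self[of C 1 "int h"] by (simp add: int_pow_int)
  moreover have "cj C (A [^] s) = A [^] s"
    using cj_pow_self[of C 1 "int n"] by (simp add: w cj_int_pow int_pow_int)
  ultimately have "cj C (A [^] h) = A [^] h" by (simp add: cj_mult)
  then have "A [^] (\<alpha> * int h) = A [^] int h" by (simp add: cj_int_pow cj_C_A int_pow_pow flip: int_pow_int)
  then have "int (ord A) dvd (\<alpha> - 1) * int h" by (simp add: int_pow_eq_iff_dvd algebra_simps)
  moreover have "int (ord A) dvd 4 * int h"
    using assms(2) by (metis int_dvd_int_iff of_nat_mult of_nat_numeral)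
  ultimately have "int (ord A) dvd gcd ((\<alpha> - 1) * int h) (4 * int h)" by simp
  also have "gcd ((\<alpha> - 1) * int h) (4 * int h) = 2 * int h"
  proof -
    have "gcd 4 (\<alpha> - 1) = 2"
    proof -
      have "(\<alpha> - 1) mod 4 = 2" using \<alpha>_mod_4 by presburger
      then show ?thesis using gcd_red_int[of "\<alpha> - 1" 4] gcd_red_int[of 4 2] by (simp add: gcd.commute)
    qed
    then show ?thesis by (simp add: gcd_mult_right gcd_mult_left)
  qed
  finally show ?thesis by (metis int_dvd_int_iff of_nat_mult of_nat_numeral)
qed

lemma obtain_exponent:
  obtains m where "m mod 4 = 1" "ord A dvd 4 * m" "ord B dvd 4 * m"
proof -
  interpret S: good_macdonald G B A "inv C" \<beta> \<alpha> by (rule good_swap)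
  obtain e l where l: "ord A * ord B = 2 ^ e * l" "\<not> 2 dvd l"
    using ord_A_pos ord_B_pos by (metis multiplicity_decompose' mult_eq_0_iff not_gr0 not_prime_unit two_is_prime_nat)
  \<comment> \<open>Squaring the odd part \<open>l\<close> makes it 1 modulo 4 and keeps it a
    multiple of \<open>l\<close>.\<close>
  define m where "m = l * l"
  have "l mod 4 = 1 \<or> l mod 4 = 3" using l(2) by presburger
  then have m4: "m mod 4 = 1" unfolding m_def by (auto simp: mod_mult_eq[of l 4 l, symmetric])
  have "ord A dvd 2 ^ e * m" "ord B dvd 2 ^ e * m"
    using l(1) unfolding m_def by (metis dvd_mult2 dvd_triv_left dvd_triv_right mult.assoc)+
  then have "ord A dvd 4 * m \<and> ord B dvd 4 * m"
  proof (induction e)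
    case 0
    then show ?case by simp
  next
    case (Suc e)
    consider "e = 0" | "e = 1" | j where "e = Suc (Suc j)" by (metis One_nat_def not0_implies_Suc)
    then show ?case
    proof cases
      case 1
      then have "ord A dvd 2 * m" "ord B dvd 2 * m" using Suc.prems by simp_all
      then show ?thesis using dvd_trans[of _ "2 * m" "4 * m"] by simp
    next
      case 2
      then show ?thesis using Suc.prems by (simp add: mult.assoc)
    next
      case 3
      \<comment> \<open>The descent needs an even \<open>h\<close>, so it lowers the power of 2 only
        as far as 4.\<close>
      define h where "h = 2 * (2 ^ j * m)"
      have h: "2 ^ Suc e * m = 4 * h" "2 ^ e * m = 2 * h" by (simp_all add: 3 h_def)
      have "ord A dvd 4 * h" "ord B dvd 4 * h" using Suc.prems by (simp_all only: h)
      moreover have "even h" by (simp add: h_def)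
      ultimately have "ord A dvd 2 * h" "ord B dvd 2 * h"
        using ord_dvd_descent S.ord_dvd_descent by blast+
      then show ?thesis using Suc.IH by (simp only: h)
    qed
  qed
  then show ?thesis using that m4 by blast
qed

end

section \<open>The group Q16 and products with cyclic groups\<close>

lemma Q16_carrier: "carrier Q16 = {0..<8} \<times> {0..<2}"
  by (simp add: Q16_def)

lemma Q16_mult:
  "(i, j) \<otimes>\<^bsub>Q16\<^esub> (k, l) =
    ((i + (if j = 0 then k else - k) + (if j = 1 \<and> l = 1 then 4 else 0)) mod 8, (j + l) mod 2)"
  by (simp add: Q16_def)

lemma Q16_one: "\<one>\<^bsub>Q16\<^esub> = (0, 0)"
  by (simp add: Q16_def)

lemma Q16_carrierE:
  assumes "q \<in> carrier Q16"
  obtains i j where "q = (i, j)" "0 \<le> i" "i < 8" "j = 0 \<or> j = 1"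
proof -
  from assms obtain i j where "q = (i, j)" "0 \<le> i" "i < 8" "0 \<le> j" "j < 2"
    by (cases q) (auto simp: Q16_carrier)
  moreover from this have "j = 0 \<or> j = 1" by linarith
  ultimately show ?thesis using that by blast
qed

lemma mod_8_nested:
  fixes u p q :: int
  shows "(u mod 8 + p + q) mod 8 = (u + p + q) mod 8" "(u mod 8 - p + q) mod 8 = (u - p + q) mod 8"
    "(p + u mod 8 + q) mod 8 = (p + u + q) mod 8" "(p - u mod 8 + q) mod 8 = (p - u + q) mod 8"
  by (intro mod_add_cong mod_diff_cong; simp)+

lemma Q16_assoc:
  assumes "j = 0 \<or> j = 1" "l = 0 \<or> l = 1" "n = 0 \<or> n = 1"
  shows "(i, j) \<otimes>\<^bsub>Q16\<^esub> (k, l) \<otimes>\<^bsub>Q16\<^esub> (m, n) = (i, j) \<otimes>\<^bsub>Q16\<^esub> ((k, l) \<otimes>\<^bsub>Q16\<^esub> (m, n))"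
  using assms
  by (elim disjE) (simp_all add: Q16_mult mod_8_nested mod_simps, simp_all add: mod_eq_dvd_iff)

lemma group_Q16: "group Q16"
proof (rule groupI)
  fix u v assume uv: "u \<in> carrier Q16" "v \<in> carrier Q16"
  show "u \<otimes>\<^bsub>Q16\<^esub> v \<in> carrier Q16"
    using uv by (elim Q16_carrierE) (auto simp: Q16_mult Q16_carrier)
next
  show "\<one>\<^bsub>Q16\<^esub> \<in> carrier Q16" by (simp add: Q16_one Q16_carrier)
next
  fix u v w assume uvw: "u \<in> carrier Q16" "v \<in> carrier Q16" "w \<in> carrier Q16"
  show "u \<otimes>\<^bsub>Q16\<^esub> v \<otimes>\<^bsub>Q16\<^esub> w = u \<otimes>\<^bsub>Q16\<^esub> (v \<otimes>\<^bsub>Q16\<^esub> w)"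
    using uvw by (elim Q16_carrierE) (simp add: Q16_assoc)
next
  fix u assume "u \<in> carrier Q16"
  then show "\<one>\<^bsub>Q16\<^esub> \<otimes>\<^bsub>Q16\<^esub> u = u"
    by (elim Q16_carrierE) (auto simp: Q16_mult Q16_one)
  show "\<exists>v\<in>carrier Q16. v \<otimes>\<^bsub>Q16\<^esub> u = \<one>\<^bsub>Q16\<^esub>"
    using \<open>u \<in> carrier Q16\<close>
  proof (elim Q16_carrierE)
    fix i j assume u: "u = (i, j)" "0 \<le> i" "i < 8" "j = 0 \<or> j = (1::int)"
    define v where "v = (if j = 0 then (- i) mod 8 else (i + 4) mod 8, j)"
    have "v \<in> carrier Q16" using u by (auto simp: v_def Q16_carrier)
    moreover have "v \<otimes>\<^bsub>Q16\<^esub> u = \<one>\<^bsub>Q16\<^esub>"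
      using u by (auto simp: v_def Q16_mult Q16_one mod_simps mod_8_nested)
    ultimately show ?thesis by blast
  qed
qed

lemma card_Q16: "card (carrier Q16) = 16"
  by (simp add: Q16_carrier card_cartesian_product)

lemma Q16_rotation_pow: "(1, 0) [^]\<^bsub>Q16\<^esub> (n::nat) = (int n mod 8, 0)"
proof -
  interpret Q: group Q16 by (rule group_Q16)
  show ?thesis by (induction n) (auto simp: Q16_one Q16_mult mod_simps algebra_simps)
qed

lemma Q16_noncentral_pow:
  assumes "0 \<le> i" "i < 8" "m mod 4 = 1"
  shows "(i, 1) [^]\<^bsub>Q16\<^esub> (m::nat) = (i, 1)"
proof -
  interpret Q: group Q16 by (rule group_Q16)
  have c: "(i, 1) \<in> carrier Q16" using assms by (simp add: Q16_carrier)
  have "(i, 1) [^]\<^bsub>Q16\<^esub> (4::nat) = \<one>\<^bsub>Q16\<^esub>"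
    by (simp add: eval_nat_numeral Q16_mult Q16_one mod_8_nested)
  moreover have "m = 4 * (m div 4) + 1" using assms(3) by (metis mult_div_mod_eq)
  then have "(i, 1) [^]\<^bsub>Q16\<^esub> m = ((i, 1) [^]\<^bsub>Q16\<^esub> (4::nat)) [^]\<^bsub>Q16\<^esub> (m div 4) \<otimes>\<^bsub>Q16\<^esub> (i, 1)"
    using c by (metis Q.nat_pow_mult Q.nat_pow_pow Q.nat_pow_eone)
  ultimately show ?thesis using c by simp
qed

context group
begin

text \<open>Normal forms are multiplied with
  \<open>y \<otimes> x [^] k = x [^] (- k) \<otimes> y\<close>; the square of \<open>y\<close>
  accounts for the summand 4 in the multiplication of \<open>Q16\<close>.\<close>

lemma hom_from_Q16:
  assumes c: "x \<in> carrier G" "y \<in> carrier G"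
    and rel: "x [^] (8::int) = \<one>" "y \<otimes> y = x [^] (4::int)" "cj y x = inv x"
  shows "(\<lambda>(i, j). x [^] i \<otimes> y [^] j) \<in> hom Q16 G"
proof (rule homI)
  fix u v assume uv: "u \<in> carrier Q16" "v \<in> carrier Q16"
  have red: "x [^] (i mod 8) = x [^] i" for i :: int
  proof -
    have "int (ord x) dvd 8" using rel(1) c by (simp add: int_pow_eq_one_iff)
    also have "8 dvd i mod 8 - i" by presburger
    finally show ?thesis using c by (simp add: int_pow_eq_iff_dvd)
  qed
  have yx: "y \<otimes> x [^] k = x [^] (- k) \<otimes> y" for k :: int
  proof -
    have "cj y (x [^] (- k)) = inv x [^] (- k)" using c by (simp only: cj_int_pow rel(3))
    also have "\<dots> = x [^] k" using c by (simp add: int_pow_inv int_pow_neg)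
    finally have "cj y (x [^] (- k)) = x [^] k" .
    then show ?thesis using mult_cj[of y "x [^] (- k)"] c by simp
  qed
  show "(\<lambda>(i, j). x [^] i \<otimes> y [^] j) (u \<otimes>\<^bsub>Q16\<^esub> v) = (\<lambda>(i, j). x [^] i \<otimes> y [^] j) u \<otimes> (\<lambda>(i, j). x [^] i \<otimes> y [^] j) v"
    using uv
  proof (elim Q16_carrierE)
    fix i j k l
    assume *: "u = (i, j)" "j = 0 \<or> j = (1::int)" "v = (k, l)" "l = 0 \<or> l = (1::int)"
    show ?thesis
    proof (cases "j = 0")
      case True
      then show ?thesis using * c by (auto simp: Q16_mult red int_pow_mult m_assoc)
    next
      case False
      have "x [^] i \<otimes> y \<otimes> (x [^] k \<otimes> y [^] l) = x [^] i \<otimes> (y \<otimes> x [^] k) \<otimes> y [^] l"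
        using c by (simp add: m_assoc)
      also have "\<dots> = x [^] (i - k) \<otimes> (y \<otimes> y [^] l)"
        using c by (simp add: yx m_assoc int_pow_mult[symmetric] flip: m_assoc)
      finally have e: "x [^] i \<otimes> y \<otimes> (x [^] k \<otimes> y [^] l) = x [^] (i - k) \<otimes> (y \<otimes> y [^] l)" .
      show ?thesis
      proof (cases "l = 0")
        case True
        then show ?thesis using * False c e by (auto simp: Q16_mult red)
      next
        case l: False
        then show ?thesis using * False c e rel(2)
          by (auto simp: Q16_mult red int_pow_mult[symmetric])
      qed
    qed
  qed
qed (use c in auto)

lemma subgroup_cyclic_product:
  assumes H: "subgroup H G" and x: "x \<in> carrier G" "0 < ord x" and nrm: "\<And>h. h \<in> H \<Longrightarrow> cj x h \<in> H"
  shows "subgroup {x [^] (j::nat) \<otimes> h | j h. h \<in> H} G"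
proof -
  note sub = subgroup.mem_carrier[OF H]
  have nrm_pow: "cj (x [^] (j::nat)) h \<in> H" if "h \<in> H" for j h
    by (induction j) (use that x sub nrm in \<open>simp_all add: cj_by_mult\<close>)
  show ?thesis
  proof (rule subgroupI)
    show "{x [^] (j::nat) \<otimes> h | j h. h \<in> H} \<subseteq> carrier G" using x sub by auto
    show "{x [^] (j::nat) \<otimes> h | j h. h \<in> H} \<noteq> {}" using subgroup.one_closed[OF H] by blast
  next
    fix u v assume "u \<in> {x [^] (j::nat) \<otimes> h | j h. h \<in> H}" "v \<in> {x [^] (j::nat) \<otimes> h | j h. h \<in> H}"
    then obtain i j :: nat and h k where u: "u = x [^] i \<otimes> h" "h \<in> H" and v: "v = x [^] j \<otimes> k" "k \<in> H" by blast
    have "h \<otimes> x [^] j = x [^] j \<otimes> cj (x [^] j) h" using u x sub by (simp add: mult_cj)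
    then have "u \<otimes> v = x [^] (i + j) \<otimes> (cj (x [^] j) h \<otimes> k)"
      unfolding u v using u v x sub by (simp add: nat_pow_mult[symmetric] m_assoc) (simp flip: m_assoc)
    then show "u \<otimes> v \<in> {x [^] (j::nat) \<otimes> h | j h. h \<in> H}"
      using nrm_pow[OF u(2)] v(2) subgroup.m_closed[OF H] by blast
  next
    fix u assume "u \<in> {x [^] (j::nat) \<otimes> h | j h. h \<in> H}"
    then obtain i :: nat and h where u: "u = x [^] i \<otimes> h" "h \<in> H" by blast
    \<comment> \<open>Finite order turns the inverse of \<open>x [^] i\<close> into a power with
      natural exponent.\<close>
    define j where "j = (ord x - 1) * i"
    have "j + i = ord x * i" using x(2) by (cases "ord x") (simp_all add: j_def)
    then have "x [^] j \<otimes> x [^] i = \<one>" using x by (simp add: nat_pow_mult pow_eq_id)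
    then have j: "inv (x [^] i) = x [^] j" using x by (simp add: inv_equality)
    have "inv u = inv h \<otimes> x [^] j" using u x sub by (simp add: inv_mult_group j)
    also have "\<dots> = x [^] j \<otimes> cj (x [^] j) (inv h)" using u x sub by (simp add: mult_cj)
    finally show "inv u \<in> {x [^] (j::nat) \<otimes> h | j h. h \<in> H}"
      using nrm_pow subgroup.m_inv_closed[OF H u(2)] by blast
  qed
qed

text \<open>The least positive \<open>d\<close> with \<open>x [^] d\<close> in \<open>H\<close>
  counts the left cosets of \<open>H\<close> met by powers of \<open>x\<close>. The count concerns
  cosets only, so it also covers products not known to be subgroups, such as
  \<open>PBCA\<close>.\<close>

lemma card_cyclic_product:
  assumes H: "subgroup H G" "finite H" and x: "x \<in> carrier G" "0 < ord x"
  shows "\<exists>d. finite {x [^] (j::nat) \<otimes> h | j h. h \<in> H} \<and> card {x [^] (j::nat) \<otimes> h | j h. h \<in> H} = d * card H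
    \<and> (\<forall>j::nat. x [^] j \<in> H \<longrightarrow> d dvd j) \<and> x [^] d \<in> H"
proof -
  note sub = subgroup.mem_carrier[OF H(1)]
  have H1: "\<one> \<in> H" by (rule subgroup.one_closed[OF H(1)])
  define d where "d = (LEAST d. 0 < d \<and> x [^] (d::nat) \<in> H)"
  have "0 < ord x \<and> x [^] ord x \<in> H" using x H1 by simp
  then have "0 < d \<and> x [^] d \<in> H" unfolding d_def by (rule LeastI)
  then have d: "0 < d" "x [^] d \<in> H" by simp_all
  have Hpow: "h [^] (n::nat) \<in> H" if "h \<in> H" for h n
    by (induction n) (use that H1 subgroup.m_closed[OF H(1)] in auto)
  have split: "x [^] j = x [^] (j mod d) \<otimes> (x [^] d) [^] (j div d)" for j :: nat
    using x by (simp add: nat_pow_pow nat_pow_mult)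
  have dvd: "d dvd j" if "x [^] j \<in> H" for j :: nat
  proof -
    have "x [^] j \<otimes> inv ((x [^] d) [^] (j div d)) \<in> H"
      using that Hpow[OF d(2)] by (simp add: subgroup.m_closed[OF H(1)] subgroup.m_inv_closed[OF H(1)])
    moreover have "x [^] j \<otimes> inv ((x [^] d) [^] (j div d)) = x [^] (j mod d)"
      by (subst split) (use x in \<open>simp add: m_assoc\<close>)
    ultimately have "x [^] (j mod d) \<in> H" by simp
    moreover have "j mod d < d" using d by simp
    ultimately have "j mod d = 0"
      using not_less_Least[of "j mod d" "\<lambda>d. 0 < d \<and> x [^] (d::nat) \<in> H", folded d_def] by simp
    then show ?thesis by (simp add: mod_eq_0_iff_dvd)
  qed
  have "bij_betw (\<lambda>(j, h). x [^] j \<otimes> h) ({..<d} \<times> H) {x [^] (j::nat) \<otimes> h | j h. h \<in> H}"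
    unfolding bij_betw_def
  proof
    have le: "j = k \<and> h = l" if *: "j \<le> k" "k < d" "h \<in> H" "l \<in> H" "x [^] j \<otimes> h = x [^] k \<otimes> l" for j k :: nat and h l
    proof -
      have "x [^] k = x [^] j \<otimes> x [^] (k - j)" using * x by (simp add: nat_pow_mult)
      then have "x [^] j \<otimes> h = x [^] j \<otimes> (x [^] (k - j) \<otimes> l)" using * x sub by (simp add: m_assoc)
      then have "h = x [^] (k - j) \<otimes> l" using * x sub by simp
      then have "x [^] (k - j) = h \<otimes> inv l" using * x sub by (simp add: m_assoc)
      then have "x [^] (k - j) \<in> H" using * subgroup.m_closed[OF H(1)] subgroup.m_inv_closed[OF H(1)] by simp
      then have "d dvd k - j" by (rule dvd)
      then have "k - j = 0" using * by (auto dest: dvd_imp_le)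
      then have "j = k" using * by simp
      then show ?thesis using * x sub by simp
    qed
    show "inj_on (\<lambda>(j, h). x [^] j \<otimes> h) ({..<d} \<times> H)"
    proof (rule inj_onI, clarsimp)
      fix j h k l assume *: "j < d" "h \<in> H" "k < d" "l \<in> H" "x [^] j \<otimes> h = x [^] k \<otimes> l"
      show "j = k \<and> h = l"
        using le[of j k h l] le[of k j l h] * by (cases "j \<le> k") auto
    qed
    show "(\<lambda>(j, h). x [^] j \<otimes> h) ` ({..<d} \<times> H) = {x [^] (j::nat) \<otimes> h | j h. h \<in> H}"
    proof (intro equalityI subsetI)
      fix u assume "u \<in> {x [^] (j::nat) \<otimes> h | j h. h \<in> H}"
      then obtain j :: nat and h where u: "u = x [^] j \<otimes> h" "h \<in> H" by blast
      then have "u = x [^] (j mod d) \<otimes> ((x [^] d) [^] (j div d) \<otimes> h)"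
        using split[of j] x sub by (simp add: m_assoc)
      moreover have "(x [^] d) [^] (j div d) \<otimes> h \<in> H"
        using Hpow[OF d(2)] u(2) by (simp add: subgroup.m_closed[OF H(1)])
      ultimately show "u \<in> (\<lambda>(j, h). x [^] j \<otimes> h) ` ({..<d} \<times> H)"
        using d(1) by (intro image_eqI[of _ _ "(j mod d, (x [^] d) [^] (j div d) \<otimes> h)"]) auto
    qed auto
  qed
  then have "finite {x [^] (j::nat) \<otimes> h | j h. h \<in> H}" "card {x [^] (j::nat) \<otimes> h | j h. h \<in> H} = d * card H"
    using H(2) by (simp_all add: bij_betw_same_card[symmetric] bij_betw_finite[symmetric] card_cartesian_product)
  then show ?thesis using dvd d(2) by blast
qed

text \<open>The order of \<open>y [^] n\<close> divides 4, and that of \<open>y [^] (1 - n)\<close>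
  divides the odd number \<open>n\<close>, because 4 divides \<open>1 - n\<close>. Two candidates
  differ by a power of \<open>y\<close> whose order divides both a power of 2 and an odd
  number.\<close>

lemma proj2_eq:
  assumes y: "y \<in> carrier G" and n: "y [^] (4 * n) = \<one>" and m: "n mod 4 = (1::nat)"
  shows "proj2 G y = y [^] n"
proof -
  have odd_n: "odd n" using m by presburger
  have oy: "ord y dvd 4 * n" using n y by (simp add: pow_eq_id)
  have exists: "(\<exists>k. ord (y [^] n) = 2 ^ k) \<and> odd (ord (y \<otimes> inv (y [^] n)))"
  proof
    have "ord (y [^] n) dvd 2 ^ 2" using n y by (simp add: pow_eq_id[symmetric] nat_pow_pow mult.commute)
    then show "\<exists>k. ord (y [^] n) = 2 ^ k" using divides_primepow_nat[OF two_is_prime_nat] by blast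
    obtain q where q: "n = 4 * q + 1" using m by (metis mult_div_mod_eq)
    have "y \<otimes> inv (y [^] n) = y [^] (1 - int n)" using y by (simp only: int_pow_diff int_pow_1 int_pow_int)
    then have "(y \<otimes> inv (y [^] n)) [^] int n = y [^] ((1 - int n) * int n)" using y by (simp add: int_pow_pow)
    also have "\<dots> = \<one>"
    proof -
      have "(1 - int n) * int n = int (4 * n) * (- int q)" unfolding q by (simp add: algebra_simps)
      then have "int (4 * n) dvd (1 - int n) * int n" by simp
      then show ?thesis using oy y by (meson dvd_trans int_dvd_int_iff int_pow_eq_one_iff)
    qed
    finally have "ord (y \<otimes> inv (y [^] n)) dvd n" using y by (simp add: int_pow_int pow_eq_id)
    then show "odd (ord (y \<otimes> inv (y [^] n)))" using odd_n by (meson dvd_trans)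
  qed
  show ?thesis unfolding proj2_def
  proof (rule the_equality)
    show "y [^] n \<in> carrier G \<and> (\<exists>na::nat. y [^] n = y [^] na) \<and> (\<exists>k::nat. ord (y [^] n) = 2 ^ k)
        \<and> odd (ord (y \<otimes> inv (y [^] n)))"
      using exists y by auto
  next
    fix u assume "u \<in> carrier G \<and> (\<exists>n::nat. u = y [^] n) \<and> (\<exists>k::nat. ord u = 2 ^ k) \<and> odd (ord (y \<otimes> inv u))"
    then obtain l k :: nat where u: "u = y [^] l" "ord u = 2 ^ k" "odd (ord (y \<otimes> inv u))" by blast
    obtain k' where k': "ord (y [^] n) = 2 ^ k'" using exists by blast
    define w where "w = y [^] (int l - int n)"
    have wc: "w \<in> carrier G" using y by (simp add: w_def)
    have yi: "y \<otimes> inv (y [^] i) = y [^] (1 - int i)" for i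
      using y by (simp only: int_pow_diff int_pow_1 int_pow_int)
    have int_dvd: "int (ord y) dvd int i * int (ord (y [^] i))" for i
      using y pow_ord_eq_1[of "y [^] i"] by (metis int_dvd_int_iff nat_pow_closed nat_pow_pow of_nat_mult pow_eq_id)
    have int_dvd': "int (ord y) dvd (1 - int i) * int (ord (y \<otimes> inv (y [^] i)))" for i
    proof -
      have "(y \<otimes> inv (y [^] i)) [^] int (ord (y \<otimes> inv (y [^] i))) = \<one>" using y by (simp add: int_pow_int)
      then have "y [^] ((1 - int i) * int (ord (y \<otimes> inv (y [^] i)))) = \<one>"
        using y by (subst (asm) (1) yi) (simp add: int_pow_pow)
      then show ?thesis using y by (simp add: int_pow_eq_one_iff)
    qed
    have "ord w dvd 2 ^ (k + k')"
    proof -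
      have "int (ord y) dvd int l * 2 ^ k" using int_dvd[of l] u by simp
      then have 1: "int (ord y) dvd int l * 2 ^ (k + k')" by (simp add: power_add dvd_mult2 flip: mult.assoc)
      have "int (ord y) dvd int n * 2 ^ k'" using int_dvd[of n] k' by simp
      then have "int (ord y) dvd 2 ^ k * (int n * 2 ^ k')" by (rule dvd_mult)
      then have 2: "int (ord y) dvd int n * 2 ^ (k + k')"
        by (simp add: power_add mult.left_commute)
      have "int (ord y) dvd (int l - int n) * 2 ^ (k + k')" using 1 2 by (simp add: left_diff_distrib)
      then have "w [^] int (2 ^ (k + k')) = \<one>" using y by (simp add: w_def int_pow_pow int_pow_eq_one_iff)
      then show ?thesis using wc by (simp only: int_pow_int pow_eq_id)
    qed
    moreover have "ord w dvd ord (y \<otimes> inv u) * ord (y \<otimes> inv (y [^] n))" (is "_ dvd ?s * ?t")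
    proof -
      have 1: "int (ord y) dvd (1 - int l) * (int ?s * int ?t)"
        using int_dvd'[of l] u(1) by (simp flip: mult.assoc)
      have 2: "int (ord y) dvd (1 - int n) * (int ?s * int ?t)"
        using dvd_mult[OF int_dvd'[of n], of "int ?s"] by (simp only: mult.left_commute)
      have "int (ord y) dvd (1 - int n) * (int ?s * int ?t) - (1 - int l) * (int ?s * int ?t)"
        using 1 2 by (rule dvd_diff[rotated])
      then have "int (ord y) dvd (int l - int n) * int (?s * ?t)" by (simp add: algebra_simps)
      then have "w [^] int (?s * ?t) = \<one>" using y by (simp only: w_def int_pow_pow int_pow_eq_one_iff)
      then show ?thesis using wc by (simp only: int_pow_int pow_eq_id)
    qed
    moreover have "coprime (2 ^ (k + k')) (?s * ?t)" using u(3) exists by simp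
    ultimately have "ord w = 1" by (metis coprime_common_divisor_nat is_unit_gcd dvd_1_iff_1 gcd_greatest coprime_iff_gcd_eq_1)
    then have "w = \<one>" using wc by (metis pow_ord_eq_1 nat_pow_eone)
    then have "int (ord y) dvd int l - int n" using y by (simp add: w_def int_pow_eq_one_iff)
    then have "y [^] int l = y [^] int n" using y by (simp add: int_pow_eq_iff_dvd)
    then show "u = y [^] n" using u(1) by (simp add: int_pow_int)
  qed
qed

end

section \<open>The Sylow 2-subgroup\<close>

locale macdonald_exponent = good_macdonald +
  fixes m :: nat
  assumes m_mod_4: "m mod 4 = 1" and ord_A_dvd: "ord A dvd 4 * m" and ord_B_dvd: "ord B dvd 4 * m"
begin

lemma exponent_swap: "macdonald_exponent G B A (inv C) \<beta> \<alpha> m"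
proof -
  interpret S: good_macdonald G B A "inv C" \<beta> \<alpha> by (rule good_swap)
  show ?thesis by unfold_locales (simp_all add: m_mod_4 ord_A_dvd ord_B_dvd)
qed

text \<open>By \<open>proj2_eq\<close> the elements \<open>a\<close>, \<open>b\<close>,
  \<open>c\<close> are the 2-parts of \<open>A\<close>, \<open>B\<close>, \<open>C\<close>. Their
  common square \<open>z\<close> will be the image of the central involution of
  \<open>Q16\<close>.\<close>

definition "a = A [^] m"
definition "b = B [^] m"
definition "c = C [^] m"
definition "z = C [^] (2 * m)"

lemma closed [simp]: "a \<in> carrier G" "b \<in> carrier G" "c \<in> carrier G" "z \<in> carrier G"
  by (simp_all add: a_def b_def c_def z_def)

lemma m_odd: "odd m" using m_mod_4 by presburger

lemma A_double: "A [^] (2 * m) = z" and B_double: "B [^] (2 * m) = z"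
  and cj_A_z: "cj A z = z" and cj_B_z: "cj B z = z" and z_sq: "z \<otimes> z = \<one>"
proof -
  have "ord A dvd 2 * (2 * m)" "ord B dvd 2 * (2 * m)" using ord_A_dvd ord_B_dvd by simp_all
  then show "A [^] (2 * m) = z" "B [^] (2 * m) = z" "cj A z = z" "cj B z = z" "z \<otimes> z = \<one>"
    unfolding z_def using half_powers_equal[of "2 * m"] by simp_all
qed

lemma cj_C_z: "cj C z = z"
  by (rule fixed_by_C) (simp_all add: cj_A_z cj_B_z)

lemma sq: "a \<otimes> a = z" "b \<otimes> b = z" "c \<otimes> c = z"
  using A_double B_double by (simp_all add: a_def b_def c_def z_def nat_pow_mult mult_2)

lemma z_commute_if_fixed:
  assumes "y \<in> carrier G" "cj y z = z" shows "z \<otimes> y = y \<otimes> z"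
  using assms by (simp add: cj_fixed_iff)

lemma z_fixed: "cj a z = z" "cj b z = z" "cj c z = z"
  unfolding a_def b_def c_def
  using cj_by_pow_fixed[of _ z "int m"] by (simp_all add: cj_A_z cj_B_z cj_C_z int_pow_int)

lemma z_commute: "z \<otimes> a = a \<otimes> z" "z \<otimes> b = b \<otimes> z" "z \<otimes> c = c \<otimes> z"
  by (simp_all add: z_commute_if_fixed z_fixed)

lemma inv_z: "inv z = z" by (simp add: inv_equality z_sq)

lemma inv_eq: "inv a = a \<otimes> z" "inv b = b \<otimes> z" "inv c = c \<otimes> z"
proof -
  have "y \<otimes> z \<otimes> y = \<one>" if "y \<in> carrier G" "y \<otimes> y = z" "z \<otimes> y = y \<otimes> z" for y
  proof -
    have "y \<otimes> z \<otimes> y = y \<otimes> y \<otimes> z" using that by (metis closed(4) m_assoc)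
    then show ?thesis using that z_sq by simp
  qed
  then show "inv a = a \<otimes> z" "inv b = b \<otimes> z" "inv c = c \<otimes> z"
    by (simp_all add: inv_equality sq z_commute)
qed

text \<open>The order of \<open>A\<close> divides 4 times the odd number
  \<open>gcd (ord A) m\<close>. So exponents are compared modulo 4, where \<open>m\<close> is 1 and
  \<open>\<alpha>\<close> is -1, and modulo the gcd, where \<open>m\<close> and
  \<open>geom_sum \<alpha> m\<close> vanish.\<close>

lemma A_pow_eqI:
  assumes "4 dvd i - j" "int (gcd (ord A) m) dvd i - j" shows "A [^] i = A [^] (j::int)"
proof -
  define g where "g = gcd (ord A) m"
  have "g dvd m" by (simp add: g_def)
  then have "odd g" using m_odd by (meson dvd_trans)
  then have "coprime g 2" by simp
  then have "coprime g (2 * 2)" by (simp only: coprime_mult_right_iff)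
  then have cop: "coprime (4::int) (int g)"
    by (metis coprime_commute coprime_int_iff mult_2_right numeral_Bit0 of_nat_numeral)
  have "ord A dvd gcd (4 * ord A) (4 * m)" using ord_A_dvd by simp
  then have "ord A dvd 4 * g" unfolding g_def by (simp only: gcd_mult_distrib_nat)
  then have "int (ord A) dvd 4 * int g" by (metis int_dvd_int_iff of_nat_mult of_nat_numeral)
  also have "4 * int g dvd i - j" using assms cop by (intro divides_mult) (simp_all add: g_def)
  finally show ?thesis by (simp add: int_pow_eq_iff_dvd)
qed

lemma gcd_dvd_power: "int (gcd (ord A) m) dvd \<alpha> ^ m - 1"
  using gcd_dvd_geom_sum[of m] geom_sum_telescope[of \<alpha> m] by (metis dvd_mult)

lemma cj_B_a: "cj B a = c \<otimes> inv a"
proof -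
  have "A [^] (\<alpha> * geom_sum \<alpha> m) = A [^] (- int m)"
  proof (rule A_pow_eqI)
    have "\<alpha> mod 4 = 3" "geom_sum \<alpha> m mod 4 = 1" "int m mod 4 = 1"
      using \<alpha>_mod_4 geom_sum_mod_4[OF \<alpha>_mod_4 m_odd] m_mod_4 by (simp_all, presburger)
    then have "(\<alpha> * geom_sum \<alpha> m + int m) mod 4 = (3 * 1 + 1) mod 4"
      by (intro mod_add_cong mod_mult_cong) simp_all
    then show "4 dvd \<alpha> * geom_sum \<alpha> m - - int m" by (simp add: dvd_eq_mod_eq_0)
    show "int (gcd (ord A) m) dvd \<alpha> * geom_sum \<alpha> m - - int m" using gcd_dvd_geom_sum[of m] by simp
  qed
  then show ?thesis by (simp add: a_def c_def cj_B_A_pow int_pow_neg_int)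
qed

lemma cj_A_c: "cj A c = c \<otimes> z"
proof -
  have "A [^] (1 - \<alpha> ^ m) = A [^] int (2 * m)"
  proof (rule A_pow_eqI)
    have "\<alpha> ^ m mod 4 = 3" "int m mod 4 = 1"
      using power_mod_4[OF \<alpha>_mod_4 m_odd] m_mod_4 by (simp_all, presburger)
    then show "4 dvd 1 - \<alpha> ^ m - int (2 * m)" unfolding of_nat_mult by presburger
    have "int (gcd (ord A) m) dvd - (\<alpha> ^ m - 1) - 2 * int m"
      using gcd_dvd_power by (intro dvd_diff) (simp_all only: dvd_minus_iff, simp)
    then show "int (gcd (ord A) m) dvd 1 - \<alpha> ^ m - int (2 * m)" by simp
  qed
  then have "A [^] (1 - \<alpha> ^ m) = z" by (simp only: int_pow_int A_double)
  then show ?thesis by (simp add: c_def cj_A_C_pow)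
qed

lemma cj_c_a: "cj c a = inv a"
proof -
  have "A [^] (int m * \<alpha> ^ m) = A [^] (- int m)"
  proof (rule A_pow_eqI)
    have "\<alpha> ^ m mod 4 = 3" using power_mod_4[OF \<alpha>_mod_4 m_odd] .
    then have "4 dvd \<alpha> ^ m + 1" by presburger
    then have "4 dvd int m * (\<alpha> ^ m + 1)" by simp
    then show "4 dvd int m * \<alpha> ^ m - - int m" by (simp add: algebra_simps)
    show "int (gcd (ord A) m) dvd int m * \<alpha> ^ m - - int m" by simp
  qed
  moreover have "cj c a = A [^] (int m * \<alpha> ^ m)"
    unfolding c_def a_def using cj_C_pow_A[of m "int m"] by (simp add: int_pow_int)
  ultimately show ?thesis by (simp add: a_def int_pow_neg_int)
qed

lemma cj_A_b: "cj A b = inv c \<otimes> inv b" and cj_B_c: "cj B c = c \<otimes> z"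
proof -
  interpret S: macdonald_exponent G B A "inv C" \<beta> \<alpha> m by (rule exponent_swap)
  have eqs: "S.a = b" "S.c = inv c" "S.z = z"
    by (simp_all add: S.a_def b_def S.c_def c_def S.z_def nat_pow_inv z_def[symmetric] inv_z)
  show "cj A b = inv c \<otimes> inv b" using S.cj_B_a by (simp add: eqs)
  have "cj B (inv c) = inv c \<otimes> z" using S.cj_A_c by (simp add: eqs)
  then have "cj B c = inv (inv c \<otimes> z)" by (metis B_closed cj_inv closed(3) inv_closed inv_inv)
  then show "cj B c = c \<otimes> z" by (simp add: inv_mult_group inv_z z_commute)
qed

lemma cj_inv_c_a: "cj (inv c) a = inv a"
proof -
  have "cj (inv c) (cj c a) = cj (inv c) (inv a)" by (simp add: cj_c_a)
  then have "a = inv (cj (inv c) a)" by (simp add: cj_inv)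
  then show ?thesis by (metis cj_closed closed(1,3) inv_closed inv_inv)
qed

text \<open>Conjugating twice by \<open>B\<close> fixes \<open>a\<close>, and \<open>m\<close> is
  odd, so \<open>b\<close> acts on \<open>a\<close> as \<open>B\<close> does.\<close>

lemma cj_b_a: "cj b a = c \<otimes> inv a"
proof -
  have "cj B (cj B a) = c \<otimes> z \<otimes> inv (c \<otimes> inv a)" by (simp add: cj_B_a cj_mult cj_B_c cj_inv)
  also have "\<dots> = z \<otimes> (c \<otimes> a \<otimes> inv c)" by (simp add: inv_mult_group m_assoc[symmetric] z_commute)
  also have "c \<otimes> a \<otimes> inv c = inv a" using cj_inv_c_a by (simp add: cj_def)
  also have "z \<otimes> inv a = a" 
    by (metis closed(1,4) inv_eq(1) m_assoc r_one z_commute(1) z_sq)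
  finally have "cj (B [^] (2::nat)) a = a" by (simp add: eval_nat_numeral cj_by_mult)
  then have "cj ((B [^] (2::nat)) [^] int (m div 2)) a = a" by (rule cj_by_pow_fixed[rotated 2]) simp_all
  then have B2: "cj (B [^] (2 * (m div 2))) a = a" by (simp add: int_pow_int nat_pow_pow)
  have "b = B [^] (2 * (m div 2)) \<otimes> B"
    unfolding b_def using m_odd nat_pow_Suc[of B "2 * (m div 2)"] by (metis odd_two_times_div_two_succ Suc_eq_plus1)
  then show ?thesis by (simp add: cj_by_mult B2 cj_B_a)
qed

section \<open>A pair satisfying the relations of \<open>Q16\<close>\<close>

definition "x = a \<otimes> b"

lemma x_closed [simp]: "x \<in> carrier G" by (simp add: x_def)

lemma cj_a_x: "cj a x = inv x"
proof -
  have "cj a x = b \<otimes> a" by (simp add: cj_def x_def m_assoc[symmetric])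
  moreover have "b \<otimes> a \<otimes> x = \<one>"
  proof -
    have "b \<otimes> a \<otimes> x = b \<otimes> (a \<otimes> a) \<otimes> b" by (simp add: x_def m_assoc)
    also have "\<dots> = z \<otimes> (b \<otimes> b)" by (metis closed(2,4) m_assoc sq(1) z_commute(2))
    finally show ?thesis by (simp add: sq z_sq)
  qed
  ultimately show ?thesis by (simp add: inv_equality)
qed

text \<open>Moving \<open>a\<close> past \<open>b\<close> produces
  \<open>cj b a = c \<otimes> inv a\<close>, and everything except \<open>c\<close> cancels.
  Consequently \<open>x [^] 4\<close> is \<open>z\<close>, the square of \<open>a\<close>.\<close>

lemma x_sq: "x \<otimes> x = c"
proof -
  have "x \<otimes> x = a \<otimes> (b \<otimes> b) \<otimes> cj b a"
    using mult_cj[of b a] by (simp add: x_def m_assoc)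
  also have "\<dots> = z \<otimes> a \<otimes> (c \<otimes> inv a)" by (simp add: sq cj_b_a z_commute)
  also have "\<dots> = z \<otimes> (a \<otimes> c \<otimes> inv a)" by (simp add: m_assoc)
  also have "a \<otimes> c = c \<otimes> inv a" using mult_cj[of c a] by (simp add: cj_c_a)
  also have "c \<otimes> inv a \<otimes> inv a = c \<otimes> z"
    by (simp add: m_assoc inv_mult_group[symmetric] sq inv_z)
  also have "z \<otimes> (c \<otimes> z) = c" by (simp add: z_commute m_assoc z_sq flip: m_assoc) (simp add: m_assoc z_sq)
  finally show ?thesis .
qed

lemma x_pow: "x [^] (2::int) = c" "x [^] (4::int) = z" "x [^] (8::int) = \<one>"
proof -
  show 2: "x [^] (2::int) = c" using int_pow_mult[of x 1 1] x_sq by simp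
  show 4: "x [^] (4::int) = z" using int_pow_mult[of x 2 2] sq(3) by (simp add: 2)
  show "x [^] (8::int) = \<one>" using int_pow_mult[of x 4 4] z_sq by (simp add: 4)
qed

definition \<Psi> :: "int \<times> int \<Rightarrow> 'a" where
  "\<Psi> = (\<lambda>(i, j). x [^] i \<otimes> a [^] j)"

lemma \<Psi>_hom: "\<Psi> \<in> hom Q16 G"
  unfolding \<Psi>_def by (rule hom_from_Q16) (simp_all add: x_pow sq cj_a_x)

lemma \<Psi>_group_hom: "group_hom Q16 G \<Psi>"
  by (simp add: group_hom_def group_hom_axioms_def \<Psi>_hom group_Q16 is_group)

definition P where "P = \<Psi> ` carrier Q16"

lemma P_subgroup: "subgroup P G"
  unfolding P_def using group_hom.img_is_subgroup[OF \<Psi>_group_hom] .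

lemma finite_P: "finite P" by (simp add: P_def Q16_carrier)

lemma generators_in_P: "a \<in> P" "x \<in> P" "c \<in> P" "b \<in> P" "z \<in> P"
proof -
  have "\<Psi> (0, 1) = a" "\<Psi> (1, 0) = x" by (simp_all add: \<Psi>_def)
  moreover have "(0, 1) \<in> carrier Q16" "(1, 0) \<in> carrier Q16" by (simp_all add: Q16_carrier)
  ultimately show ax: "a \<in> P" "x \<in> P" unfolding P_def by (metis image_eqI)+
  show "c \<in> P" using subgroup.m_closed[OF P_subgroup ax(2) ax(2)] by (simp add: x_sq)
  show "z \<in> P" using subgroup.m_closed[OF P_subgroup ax(1) ax(1)] by (simp add: sq)
  have "inv a \<otimes> x = b" by (simp add: x_def m_assoc[symmetric])
  then show "b \<in> P"
    using subgroup.m_closed[OF P_subgroup subgroup.m_inv_closed[OF P_subgroup ax(1)] ax(2)] by simp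
qed

lemma cj_P:
  assumes g: "g \<in> carrier G" and "cj g x \<in> P" "cj g a \<in> P" and "p \<in> P"
  shows "cj g p \<in> P"
proof -
  from \<open>p \<in> P\<close> obtain i j :: int where "p = x [^] i \<otimes> a [^] j" by (auto simp: P_def \<Psi>_def)
  then have "cj g p = cj g x [^] i \<otimes> cj g a [^] j" using g by (simp add: cj_mult cj_int_pow)
  then show ?thesis
    using assms subgroup_int_pow_closed[OF P_subgroup] subgroup.m_closed[OF P_subgroup] by simp
qed

lemma cj_A_P: "p \<in> P \<Longrightarrow> cj A p \<in> P"
proof (rule cj_P)
  have a: "cj A a = a" using cj_pow_self[of A 1 "int m"] by (simp add: a_def int_pow_int)
  show "cj A a \<in> P" using a generators_in_P by simp
  have "cj A x = a \<otimes> (inv c \<otimes> inv b)" by (simp add: x_def cj_mult a cj_A_b)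
  then show "cj A x \<in> P"
    using generators_in_P subgroup.m_closed[OF P_subgroup] subgroup.m_inv_closed[OF P_subgroup] by simp
qed simp_all

lemma cj_B_P: "p \<in> P \<Longrightarrow> cj B p \<in> P"
proof (rule cj_P)
  have b: "cj B b = b" using cj_pow_self[of B 1 "int m"] by (simp add: b_def int_pow_int)
  show "cj B a \<in> P"
    using generators_in_P subgroup.m_closed[OF P_subgroup] subgroup.m_inv_closed[OF P_subgroup]
    by (simp add: cj_B_a)
  then show "cj B x \<in> P"
    using generators_in_P subgroup.m_closed[OF P_subgroup] by (simp add: x_def cj_mult b)
qed simp_all

end

text \<open>The assumption \<open>generated\<close> is induction over words. The value
  \<open>(3, 1)\<close> is chosen so that \<open>A \<otimes> B\<close>, and with it
  \<open>x\<close>, is sent to \<open>(1, 0)\<close>; this makes \<open>\<phi>\<close> a left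
  inverse of \<open>\<Psi>\<close>.\<close>

locale macdonald_Q16 = macdonald_exponent +
  fixes \<phi> :: "'a \<Rightarrow> int \<times> int"
  assumes generated: "\<And>S. \<one> \<in> S \<Longrightarrow> (\<And>g s. g \<in> {A, B, inv A, inv B} \<Longrightarrow> s \<in> S \<Longrightarrow> s \<in> carrier G \<Longrightarrow> g \<otimes> s \<in> S)
      \<Longrightarrow> carrier G \<subseteq> S"
    and \<phi>_hom: "\<phi> \<in> hom G Q16" and \<phi>_A: "\<phi> A = (0, 1)" and \<phi>_B: "\<phi> B = (3, 1)"
begin

lemma \<phi>_group_hom: "group_hom G Q16 \<phi>"
  by (simp add: group_hom_def group_hom_axioms_def \<phi>_hom group_Q16 is_group)

lemma \<phi>_\<Psi>: assumes "q \<in> carrier Q16" shows "\<phi> (\<Psi> q) = q"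
  using assms
proof (elim Q16_carrierE)
  interpret \<phi>: group_hom G Q16 \<phi> by (rule \<phi>_group_hom)
  fix i j assume q: "q = (i, j)" "0 \<le> i" "i < 8" "j = 0 \<or> j = (1::int)"
  have a: "\<phi> a = (0, 1)" by (simp add: a_def \<phi>.hom_nat_pow \<phi>_A Q16_noncentral_pow m_mod_4)
  have b: "\<phi> b = (3, 1)" by (simp add: b_def \<phi>.hom_nat_pow \<phi>_B Q16_noncentral_pow m_mod_4)
  have x: "\<phi> x = (1, 0)" by (simp add: x_def a b Q16_mult)
  have "\<phi> (x [^] nat i) = (1, 0) [^]\<^bsub>Q16\<^esub> nat i" by (simp only: \<phi>.hom_nat_pow x_closed x)
  also have "\<dots> = (i, 0)" using q unfolding Q16_rotation_pow by simp
  finally have "\<phi> (x [^] nat i) = (i, 0)" .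
  then have xi: "\<phi> (x [^] i) = (i, 0)" using q(2) int_pow_int[of G x "nat i"] by simp
  show "\<phi> (\<Psi> q) = q" using q(4)
  proof
    assume "j = 0"
    then show ?thesis using xi by (simp add: q \<Psi>_def)
  next
    assume "j = 1"
    then show ?thesis using q(2,3) by (simp add: q(1) \<Psi>_def xi a Q16_mult)
  qed
qed

lemma \<Psi>_inj: "inj_on \<Psi> (carrier Q16)"
  by (rule inj_on_inverseI) (rule \<phi>_\<Psi>)

lemma card_P: "card P = 16"
  unfolding P_def using card_image[OF \<Psi>_inj] card_Q16 by simp

text \<open>Conjugation by \<open>A\<close> or \<open>B\<close> maps the finite set \<open>P\<close>
  injectively into itself, hence onto, so the inverses preserve \<open>P\<close> too.\<close>

lemma cj_P_all: assumes "g \<in> carrier G" "p \<in> P" shows "cj g p \<in> P"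
proof -
  have PC: "P \<subseteq> carrier G" using subgroup.subset[OF P_subgroup] .
  have step: "cj h ` P = P" if "h \<in> carrier G" "\<And>p. p \<in> P \<Longrightarrow> cj h p \<in> P" for h
    by (rule endo_inj_surj[OF finite_P]) (use that PC in \<open>auto intro!: inj_onI dest: cj_eqD[rotated 3]\<close>)
  have inv_step: "cj (inv h) p \<in> P" if "h \<in> carrier G" "cj h ` P = P" "p \<in> P" for h p
  proof -
    from that(2,3) obtain p' where p': "p' \<in> P" "p = cj h p'" by blast
    then show ?thesis using that(1) PC by auto
  qed
  have "carrier G \<subseteq> {g \<in> carrier G. \<forall>p\<in>P. cj g p \<in> P}"
  proof (rule generated)
    fix g s assume *: "g \<in> {A, B, inv A, inv B}" "s \<in> {g \<in> carrier G. \<forall>p\<in>P. cj g p \<in> P}" "s \<in> carrier G"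
    have "cj g p \<in> P" if "p \<in> P" for p
      using *(1) that cj_A_P cj_B_P inv_step[OF A_closed step] inv_step[OF B_closed step] by auto
    moreover have "g \<in> carrier G" using *(1) by auto
    ultimately show "g \<otimes> s \<in> {g \<in> carrier G. \<forall>p\<in>P. cj g p \<in> P}"
      using *(2) PC by (auto simp: cj_by_mult)
  qed (use PC in auto)
  then show ?thesis using assms by blast
qed

section \<open>The group as a product of \<open>P\<close> with three cyclic groups\<close>

definition "PB = {B [^] (j::nat) \<otimes> h | j h. h \<in> P}"
definition "PBC = {C [^] (j::nat) \<otimes> h | j h. h \<in> PB}"
definition "PBCA = {A [^] (j::nat) \<otimes> h | j h. h \<in> PBC}"

lemma PB_subgroup: "subgroup PB G"
  unfolding PB_def by (rule subgroup_cyclic_product[OF P_subgroup]) (simp_all add: ord_B_pos cj_B_P)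

lemma in_PB: "h \<in> P \<Longrightarrow> h \<in> PB" "B \<in> PB"
proof -
  show "h \<in> PB" if "h \<in> P"
    unfolding PB_def using that subgroup.mem_carrier[OF P_subgroup that]
    by (intro CollectI exI[of _ "0::nat"] exI[of _ h]) simp
  show "B \<in> PB" unfolding PB_def using subgroup.one_closed[OF P_subgroup]
    by (intro CollectI exI[of _ "1::nat"] exI[of _ \<one>]) simp
qed

lemma inv_pow: assumes "g \<in> carrier G" "0 < ord g" shows "\<exists>n::nat. inv g = g [^] n"
proof
  have "g [^] (ord g - 1) \<otimes> g = g [^] Suc (ord g - 1)" by simp
  also have "Suc (ord g - 1) = ord g" using assms by simp
  finally show "inv g = g [^] (ord g - 1)" using assms pow_ord_eq_1[of g] by (simp add: inv_equality)
qed

text \<open>The relation describes conjugation by \<open>inv C\<close>. As \<open>C\<close> has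
  finite order, \<open>C\<close> is a power of \<open>inv C\<close> and also sends \<open>B\<close>
  to a power of \<open>B\<close>.\<close>

lemma PBC_subgroup: "subgroup PBC G"
  unfolding PBC_def
proof (rule subgroup_cyclic_product[OF PB_subgroup])
  fix h assume "h \<in> PB"
  then obtain j :: nat and p where h: "h = B [^] j \<otimes> p" "p \<in> P" by (auto simp: PB_def)
  obtain n :: nat where n: "inv (inv C) = inv C [^] n" using inv_pow[of "inv C"] ord_C_pos' by auto
  have "cj C B = B [^] (\<beta> ^ n)"
    using n cj_by_nat_pow_power[of "inv C" B \<beta> n 1] cj_inv_C_B by simp
  then have "cj C h = (B [^] (\<beta> ^ n)) [^] j \<otimes> cj C p"
    using h subgroup.mem_carrier[OF P_subgroup] by (simp add: cj_mult cj_nat_pow)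
  moreover have "(B [^] (\<beta> ^ n)) [^] int j \<in> PB"
    using in_PB(2) by (intro subgroup_int_pow_closed[OF PB_subgroup])
  moreover have "cj C p \<in> PB" using in_PB(1) cj_P_all h(2) by simp
  ultimately show "cj C h \<in> PB" using subgroup.m_closed[OF PB_subgroup] by (simp add: int_pow_int)
qed (simp_all add: ord_C_pos')

lemma in_PBC: "h \<in> PB \<Longrightarrow> h \<in> PBC" "C \<in> PBC"
proof -
  show "h \<in> PBC" if "h \<in> PB"
    unfolding PBC_def using that subgroup.mem_carrier[OF PB_subgroup that]
    by (intro CollectI exI[of _ "0::nat"] exI[of _ h]) simp
  show "C \<in> PBC" unfolding PBC_def using subgroup.one_closed[OF PB_subgroup]
    by (intro CollectI exI[of _ "1::nat"] exI[of _ \<one>]) simp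
qed

lemma pow_mult_closed:
  assumes "g \<in> carrier G" "\<And>s. s \<in> S \<Longrightarrow> g \<otimes> s \<in> S" "S \<subseteq> carrier G" "s \<in> S"
  shows "g [^] (n::nat) \<otimes> s \<in> S"
proof (induction n)
  case (Suc n)
  have "g [^] Suc n \<otimes> s = g \<otimes> (g [^] n \<otimes> s)"
    using assms by (simp only: nat_pow_Suc2) (auto simp: m_assoc)
  then show ?case using Suc assms(2) by simp
qed (use assms in auto)

text \<open>Left multiplication by \<open>inv B\<close> turns \<open>A [^] j \<otimes> h\<close>
  into \<open>cj B (A [^] j) \<otimes> (inv B \<otimes> h)\<close>. The first factor is a power of
  \<open>C\<close> times a power of \<open>A\<close>; exchanging the two restores the normal form.
  Finite orders then handle \<open>inv A\<close> and \<open>B\<close>.\<close>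

lemma carrier_eq: "carrier G = PBCA"
proof
  have sub: "PBCA \<subseteq> carrier G" using subgroup.mem_carrier[OF PBC_subgroup] by (auto simp: PBCA_def)
  then show "PBCA \<subseteq> carrier G" .
  have Apow: "A [^] (i::int) \<otimes> h \<in> PBCA" if "h \<in> PBC" for i h
  proof -
    define n where "n = nat (i mod int (ord A))"
    have "int n = i mod int (ord A)" using ord_A_pos by (simp add: n_def)
    then have "A [^] i = A [^] int n" by (simp add: int_pow_eq_iff_dvd minus_mod_eq_mult_div)
    then show ?thesis using that unfolding PBCA_def by (auto simp: int_pow_int)
  qed
  have A: "A \<otimes> s \<in> PBCA" if "s \<in> PBCA" for s
  proof -
    from that obtain j :: nat and h where s: "s = A [^] j \<otimes> h" "h \<in> PBC" by (auto simp: PBCA_def)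
    have "A \<otimes> s = A [^] Suc j \<otimes> h"
      using s subgroup.mem_carrier[OF PBC_subgroup] by (simp only: nat_pow_Suc2 A_closed) (simp add: m_assoc)
    then show ?thesis using s(2) unfolding PBCA_def by blast
  qed
  have iB: "inv B \<otimes> s \<in> PBCA" if "s \<in> PBCA" for s
  proof -
    from that obtain j :: nat and h where s: "s = A [^] j \<otimes> h" "h \<in> PBC" by (auto simp: PBCA_def)
    note hc = subgroup.mem_carrier[OF PBC_subgroup s(2)]
    obtain l :: nat where l: "inv (C [^] j) = C [^] l"
    proof -
      obtain n :: nat where "inv C = C [^] n" using inv_pow[of C] ord_C_pos' by auto
      then have "inv (C [^] j) = C [^] (n * j)" by (simp add: nat_pow_inv[symmetric] nat_pow_pow)
      then show ?thesis using that by blast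
    qed
    define t where "t = \<alpha> * geom_sum \<alpha> j"
    have "cj (C [^] l) (A [^] t) = A [^] (t * \<alpha> ^ l)" by (rule cj_C_pow_A)
    then have "C [^] j \<otimes> A [^] t \<otimes> inv (C [^] j) = A [^] (t * \<alpha> ^ l)"
      unfolding l[symmetric] by (simp add: cj_def)
    then have CA: "C [^] j \<otimes> A [^] t = A [^] (t * \<alpha> ^ l) \<otimes> C [^] j"
      by (metis A_closed C_closed int_pow_closed inv_solve_right m_closed nat_pow_closed)
    have "inv B \<otimes> s = cj B (A [^] j) \<otimes> (inv B \<otimes> h)"
    proof -
      have "cj B (A [^] j) \<otimes> (inv B \<otimes> h) = inv B \<otimes> A [^] j \<otimes> (B \<otimes> inv B) \<otimes> h"
        unfolding cj_def using hc by (simp only: m_assoc m_closed inv_closed B_closed A_closed nat_pow_closed)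
      then show ?thesis using hc s(1) by (simp add: m_assoc)
    qed
    also have "\<dots> = A [^] (t * \<alpha> ^ l) \<otimes> (C [^] j \<otimes> (inv B \<otimes> h))"
      using hc CA by (simp add: cj_B_A_pow t_def[symmetric] m_assoc)
    also have "\<dots> \<in> PBCA"
    proof (rule Apow)
      have "C [^] int j \<in> PBC" using in_PBC(2) by (rule subgroup_int_pow_closed[OF PBC_subgroup])
      moreover have "inv B \<in> PBC"
        using in_PBC(1) in_PB(2) subgroup.m_inv_closed[OF PBC_subgroup] by blast
      ultimately show "C [^] j \<otimes> (inv B \<otimes> h) \<in> PBC"
        using s(2) subgroup.m_closed[OF PBC_subgroup] by (simp add: int_pow_int)
    qed
    finally show ?thesis .
  qed
  obtain k :: nat where k: "inv A = A [^] k" using inv_pow[of A] ord_A_pos by auto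
  obtain l :: nat where l: "inv (inv B) = inv B [^] l" using inv_pow[of "inv B"] ord_B_pos by auto
  show "carrier G \<subseteq> PBCA"
  proof (rule generated)
    have "\<one> \<in> PBC" by (rule subgroup.one_closed[OF PBC_subgroup])
    then show "\<one> \<in> PBCA" using Apow[of \<one> 0] by simp
  next
    fix g s assume geom_sum: "g \<in> {A, B, inv A, inv B}" "s \<in> PBCA" "s \<in> carrier G"
    have "inv A \<otimes> s \<in> PBCA" unfolding k by (rule pow_mult_closed[OF _ A sub geom_sum(2)]) simp_all
    moreover have "inv (inv B) \<otimes> s \<in> PBCA" unfolding l by (rule pow_mult_closed[OF _ iB sub geom_sum(2)]) simp_all
    ultimately show "g \<otimes> s \<in> PBCA" using geom_sum A iB by auto
  qed
qed

text \<open>Each of the three indices divides the odd number \<open>m\<close>, since the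
  \<open>m\<close>-th powers of \<open>B\<close>, \<open>C\<close> and \<open>A\<close> lie in
  \<open>P\<close>.\<close>

lemma order_eq: "\<exists>d. odd d \<and> card (carrier G) = d * 16"
proof -
  obtain d1 where d1: "finite PB" "card PB = d1 * card P" "\<And>j::nat. B [^] j \<in> P \<Longrightarrow> d1 dvd j"
    using card_cyclic_product[OF P_subgroup finite_P B_closed ord_B_pos] unfolding PB_def by blast
  obtain d2 where d2: "finite PBC" "card PBC = d2 * card PB" "\<And>j::nat. C [^] j \<in> PB \<Longrightarrow> d2 dvd j"
    using card_cyclic_product[OF PB_subgroup d1(1) C_closed ord_C_pos'] unfolding PBC_def by blast
  obtain d3 where d3: "finite PBCA" "card PBCA = d3 * card PBC" "\<And>j::nat. A [^] j \<in> PBC \<Longrightarrow> d3 dvd j"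
    using card_cyclic_product[OF PBC_subgroup d2(1) A_closed ord_A_pos] unfolding PBCA_def by blast
  have "d1 dvd m" "d2 dvd m" "d3 dvd m"
    using generators_in_P in_PB in_PBC by (auto intro!: d1(3) d2(3) d3(3) simp flip: a_def b_def c_def)
  then have "odd (d3 * d2 * d1)" using m_odd by (metis dvd_trans even_mult_iff)
  moreover have "card (carrier G) = d3 * d2 * d1 * 16" by (simp add: carrier_eq d1 d2 d3 card_P)
  ultimately show ?thesis by blast
qed

text \<open>Elements of \<open>P\<close> have order dividing 16. Conversely, the powers of a
  2-element times the normal subgroup \<open>P\<close> form a subgroup whose index over
  \<open>P\<close> is a power of 2 and divides the odd index of \<open>P\<close> in the whole
  group.\<close>

lemma two_elems_eq: "two_elems G = P"
proof
  show "P \<subseteq> two_elems G"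
  proof
    fix p assume p: "p \<in> P"
    then have pc: "p \<in> carrier G" using subgroup.mem_carrier[OF P_subgroup] by blast
    interpret PG: group "G\<lparr>carrier := P\<rparr>" by (rule subgroup_imp_group[OF P_subgroup])
    have "p [^]\<^bsub>G\<lparr>carrier := P\<rparr>\<^esub> Coset.order (G\<lparr>carrier := P\<rparr>) = \<one>\<^bsub>G\<lparr>carrier := P\<rparr>\<^esub>"
      by (rule PG.pow_order_eq_1) (simp add: p)
    then have "p [^] (16::nat) = \<one>" by (simp add: Coset.order_def card_P nat_pow_consistent[symmetric])
    then have "ord p dvd 2 ^ 4" using pc by (simp add: pow_eq_id)
    then have "\<exists>k. ord p = 2 ^ k" using divides_primepow_nat[OF two_is_prime_nat] by blast
    then show "p \<in> two_elems G" using pc by (simp add: two_elems_def)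
  qed
  show "two_elems G \<subseteq> P"
  proof
    fix g assume "g \<in> two_elems G"
    then obtain k where g: "g \<in> carrier G" "ord g = 2 ^ k" by (auto simp: two_elems_def)
    define H where "H = {g [^] (j::nat) \<otimes> h | j h. h \<in> P}"
    have o: "0 < ord g" by (simp add: g)
    have H: "subgroup H G" unfolding H_def by (rule subgroup_cyclic_product[OF P_subgroup g(1) o]) (simp add: cj_P_all g)
    obtain d where d: "card H = d * card P" "\<And>j::nat. g [^] j \<in> P \<Longrightarrow> d dvd j" "g [^] d \<in> P"
      using card_cyclic_product[OF P_subgroup finite_P g(1) o] unfolding H_def by blast
    have "g [^] (2 ^ k :: nat) = \<one>" using g pow_ord_eq_1[of g] by simp
    then have dk: "d dvd 2 ^ k" using d(2) subgroup.one_closed[OF P_subgroup] by simp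
    obtain e where e: "odd e" "card (carrier G) = e * 16" using order_eq by blast
    have "card H dvd Coset.order G" using lagrange[OF H] by (metis dvd_triv_right)
    then have "d dvd e" by (simp add: d(1) card_P Coset.order_def e(2))
    then have "odd d" using e(1) by (meson dvd_trans)
    then have "coprime d (2 ^ k)" by simp
    then have "d = 1" using dk coprime_absorb_left[OF dk] by simp
    then show "g \<in> P" using d(3) g(1) by simp
  qed
qed

lemma sylow2_eq: "sylow2 G = G\<lparr>carrier := P\<rparr>"
  by (simp add: sylow2_def two_elems_eq)

lemma \<Psi>_iso: "\<Psi> \<in> iso Q16 (sylow2 G)"
proof -
  have "\<Psi> \<in> hom Q16 (G\<lparr>carrier := P\<rparr>)" using \<Psi>_hom by (auto simp: hom_def P_def)
  moreover have "bij_betw \<Psi> (carrier Q16) P" unfolding bij_betw_def using \<Psi>_inj by (simp add: P_def)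
  ultimately show ?thesis by (simp add: iso_def sylow2_eq)
qed

lemma ord_4: assumes "y \<in> carrier G" "y \<otimes> y = z" shows "ord y = 4"
proof -
  have z1: "z \<noteq> \<one>"
  proof
    assume "z = \<one>"
    then have "\<Psi> (4, 0) = \<Psi> (0, 0)" by (simp add: \<Psi>_def x_pow)
    then have "(4, 0) = (0::int, 0::int)" by (rule inj_onD[OF \<Psi>_inj]) (simp_all add: Q16_carrier)
    then show False by simp
  qed
  have y2: "y [^] (2::nat) = z" using assms by (simp add: eval_nat_numeral)
  then have "\<not> ord y dvd 2" using z1 assms(1) by (metis pow_eq_id)
  moreover have "y [^] (2 + 2 :: nat) = \<one>" using assms(1) by (simp only: nat_pow_mult[symmetric] y2 z_sq)
  then have "ord y dvd 2 ^ 2" using assms(1) by (simp add: pow_eq_id)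
  then obtain i where "i \<le> 2" "ord y = 2 ^ i" using divides_primepow_nat[OF two_is_prime_nat] by blast
  moreover from this have "i = 0 \<or> i = 1 \<or> i = 2" by linarith
  ultimately show ?thesis by auto
qed

lemma ord_proj2:
  "ord (proj2 G A) = 4" "ord (proj2 G B) = 4" "ord (proj2 G C) = 4"
proof -
  have "A [^] (4 * m) = \<one>" "B [^] (4 * m) = \<one>" using ord_A_dvd ord_B_dvd by (simp_all add: pow_eq_id)
  moreover have "C [^] (2 * m + 2 * m) = \<one>" using z_sq unfolding z_def by (simp only: nat_pow_mult C_closed)
  then have "C [^] (4 * m) = \<one>" by simp
  ultimately have "proj2 G A = a" "proj2 G B = b" "proj2 G C = c"
    unfolding a_def b_def c_def by (simp_all add: proj2_eq m_mod_4)
  then show "ord (proj2 G A) = 4" "ord (proj2 G B) = 4" "ord (proj2 G C) = 4"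
    by (simp_all add: ord_4 sq)
qed

end

section \<open>Lower central series\<close>

lemma Q16_inv:
  "(i, 0) \<in> carrier Q16 \<Longrightarrow> inv\<^bsub>Q16\<^esub> (i, 0) = ((- i) mod 8, 0)"
  "(i, 1) \<in> carrier Q16 \<Longrightarrow> inv\<^bsub>Q16\<^esub> (i, 1) = ((i + 4) mod 8, 1)"
proof -
  interpret Q: group Q16 by (rule group_Q16)
  show "inv\<^bsub>Q16\<^esub> (i, 0) = ((- i) mod 8, 0)" if "(i, 0) \<in> carrier Q16"
    by (rule Q.inv_equality) (use that in \<open>auto simp: Q16_mult Q16_one Q16_carrier mod_simps\<close>)
  show "inv\<^bsub>Q16\<^esub> (i, 1) = ((i + 4) mod 8, 1)" if "(i, 1) \<in> carrier Q16"
    by (rule Q.inv_equality) (use that in \<open>auto simp: Q16_mult Q16_one Q16_carrier mod_simps mod_8_nested\<close>)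
qed

lemma Q16_commutator:
  assumes "(i, j) \<in> carrier Q16" "(k, l) \<in> carrier Q16"
  shows "commutator Q16 (i, j) (k, l) =
    ((2 * (if j = 0 then if l = 0 then 0 else - i else if l = 0 then k else i - k)) mod 8, 0)"
proof -
  have "j = 0 \<or> j = 1" "l = 0 \<or> l = 1" using assms by (auto simp: Q16_carrier)
  then show ?thesis using assms
    by (elim disjE)
      (simp add: commutator_def Q16_inv Q16_mult mod_8_nested mod_simps; simp add: mod_eq_dvd_iff)+
qed

definition Q16_rotations :: "int \<Rightarrow> (int \<times> int) set" where
  "Q16_rotations s = {((s * t) mod 8, 0) | t. True}"

lemma Q16_rotations_subgroup: "subgroup (Q16_rotations s) Q16"
proof -
  interpret Q: group Q16 by (rule group_Q16)
  show ?thesis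
  proof (rule Q.subgroupI)
    show "Q16_rotations s \<subseteq> carrier Q16" "Q16_rotations s \<noteq> {}"
      by (auto simp: Q16_rotations_def Q16_carrier)
  next
    fix u assume "u \<in> Q16_rotations s"
    then obtain t where u: "u = ((s * t) mod 8, 0)" by (auto simp: Q16_rotations_def)
    then have "inv\<^bsub>Q16\<^esub> u = ((s * (- t)) mod 8, 0)"
      by (simp add: Q16_inv(1) Q16_carrier mod_simps)
    then show "inv\<^bsub>Q16\<^esub> u \<in> Q16_rotations s" unfolding Q16_rotations_def by blast
  next
    fix u v assume "u \<in> Q16_rotations s" "v \<in> Q16_rotations s"
    then obtain t t' where "u = ((s * t) mod 8, 0)" "v = ((s * t') mod 8, 0)"
      by (auto simp: Q16_rotations_def)
    then have "u \<otimes>\<^bsub>Q16\<^esub> v = ((s * (t + t')) mod 8, 0)" by (simp add: Q16_mult mod_simps distrib_left)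
    then show "u \<otimes>\<^bsub>Q16\<^esub> v \<in> Q16_rotations s" unfolding Q16_rotations_def by blast
  qed
qed

lemma lcs_Suc_subset:
  assumes "group G" "subgroup H G" "\<And>x y. x \<in> lcs G n \<Longrightarrow> y \<in> carrier G \<Longrightarrow> commutator G x y \<in> H"
  shows "lcs G (Suc n) \<subseteq> H"
  unfolding lcs.simps by (rule group.generate_subgroup_incl[OF assms(1) _ assms(2)]) (auto intro: assms(3))

lemma lcs_SucI:
  "x \<in> lcs G n \<Longrightarrow> y \<in> carrier G \<Longrightarrow> commutator G x y \<in> lcs G (Suc n)"
  by (auto intro!: generate.incl)

text \<open>A rotation commutes with rotations and is inverted by all other elements, so each
  commutator step doubles the exponent.\<close>

lemma lcs_Q16_subset: "lcs Q16 (Suc n) \<subseteq> Q16_rotations (2 ^ Suc n)"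
proof (induction n)
  case 0
  show ?case
  proof (rule lcs_Suc_subset[OF group_Q16 Q16_rotations_subgroup])
    fix u v assume uv: "u \<in> lcs Q16 0" "v \<in> carrier Q16"
    obtain i j k l where "u = (i, j)" "v = (k, l)" by (cases u, cases v)
    then have "\<exists>t. commutator Q16 u v = ((2 * t) mod 8, 0)"
      using uv Q16_commutator[of i j k l] by (metis lcs.simps(1))
    then show "commutator Q16 u v \<in> Q16_rotations (2 ^ Suc 0)"
      unfolding Q16_rotations_def by simp
  qed
next
  case (Suc n)
  show ?case
  proof (rule lcs_Suc_subset[OF group_Q16 Q16_rotations_subgroup])
    fix u v assume uv: "u \<in> lcs Q16 (Suc n)" "v \<in> carrier Q16"
    then have "u \<in> Q16_rotations (2 ^ Suc n)" using subsetD[OF Suc] by simp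
    then obtain t where u: "u = ((2 ^ Suc n * t) mod 8, 0)" by (auto simp: Q16_rotations_def)
    obtain k l where v: "v = (k, l)" by (cases v)
    have "u \<in> carrier Q16" by (simp add: u Q16_carrier)
    then have "commutator Q16 u v = ((2 * (if l = 0 then 0 else - ((2 ^ Suc n * t) mod 8))) mod 8, 0)"
      using uv(2) Q16_commutator unfolding u v by presburger
    also have "\<dots> = ((2 ^ Suc (Suc n) * (if l = 0 then 0 else - t)) mod 8, 0)"
    proof -
      have "(2 * - (s mod 8)) mod 8 = (2 * - s) mod 8" for s :: int
        by (intro mod_mult_cong mod_minus_cong) simp_all
      from this[of "2 ^ Suc n * t"] show ?thesis by (simp add: mult.assoc)
    qed
    finally have "commutator Q16 u v = ((2 ^ Suc (Suc n) * (if l = 0 then 0 else - t)) mod 8, 0)" .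
    then show "commutator Q16 u v \<in> Q16_rotations (2 ^ Suc (Suc n))"
      unfolding Q16_rotations_def by blast
  qed
qed

lemma nilpotency_class_Q16: "nilpotency_class Q16 3"
proof -
  interpret Q: group Q16 by (rule group_Q16)
  have "Q16_rotations (2 ^ Suc 2) = {\<one>\<^bsub>Q16\<^esub>}" by (auto simp: Q16_rotations_def Q16_one)
  then have "lcs Q16 (Suc 2) \<subseteq> {\<one>\<^bsub>Q16\<^esub>}" using lcs_Q16_subset[of 2] by simp
  moreover have "\<one>\<^bsub>Q16\<^esub> \<in> lcs Q16 (Suc 2)" unfolding lcs.simps by (rule generate.one)
  ultimately have "lcs Q16 3 = {\<one>\<^bsub>Q16\<^esub>}" by (metis eval_nat_numeral(3) insert_absorb insert_subset subset_antisym singleton_insert_inj_eq')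
  \<comment> \<open>The commutator of \<open>(0, 1)\<close> with \<open>(1, 0)\<close> is
    \<open>(2, 0)\<close>, and that of \<open>(2, 0)\<close> with \<open>(0, 1)\<close> is
    \<open>(4, 0)\<close>; these keep the earlier terms nontrivial.\<close>
  moreover have 0: "(0, 1) \<in> lcs Q16 0" "(1, 0) \<in> carrier Q16" "(0, 1) \<in> carrier Q16" by (simp_all add: Q16_carrier)
  have 1: "(2, 0) \<in> lcs Q16 1" using lcs_SucI[OF 0(1,2)] 0 by (simp add: Q16_commutator)
  have "(2, 0) \<in> carrier Q16" by (simp add: Q16_carrier)
  then have 2: "(4, 0) \<in> lcs Q16 2" using lcs_SucI[OF 1 0(3)] 0 by (simp add: Q16_commutator numeral_2_eq_2)
  have "lcs Q16 i \<noteq> {\<one>\<^bsub>Q16\<^esub>}" if "i < 3" for i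
  proof -
    have "i = 0 \<or> i = 1 \<or> i = 2" using that by linarith
    then show ?thesis using 0(1) 1 2 by (auto simp: Q16_one simp del: lcs.simps)
  qed
  ultimately show ?thesis unfolding nilpotency_class_def by blast
qed

section \<open>Transport of the lower central series along isomorphisms\<close>

lemma commutator_hom:
  assumes "group_hom G H h" "x \<in> carrier G" "y \<in> carrier G"
  shows "h (commutator G x y) = commutator H (h x) (h y)"
proof -
  interpret group_hom G H h by fact
  show ?thesis using assms by (simp add: commutator_def)
qed

lemma lcs_subset_carrier: assumes "group G" shows "lcs G n \<subseteq> carrier G"
proof -
  interpret group G by fact
  show ?thesis
  proof (induction n)
    case (Suc n)
    show ?case unfolding lcs.simps by (rule generate_incl) (use Suc in \<open>auto simp: commutator_def\<close>)
  qed simp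
qed

lemma lcs_iso:
  assumes "group G" "group H" "h \<in> iso G H"
  shows "lcs H n = h ` lcs G n"
proof (induction n)
  case 0
  then show ?case using assms(3) by (simp add: iso_def bij_betw_def)
next
  case (Suc n)
  have gh: "group_hom G H h" using assms by (simp add: group_hom_def group_hom_axioms_def iso_def)
  interpret group_hom G H h by (rule gh)
  have sub: "lcs G n \<subseteq> carrier G" by (rule lcs_subset_carrier[OF assms(1)])
  have surj: "carrier H = h ` carrier G" using assms(3) by (simp add: iso_def bij_betw_def)
  have "{commutator H x y | x y. x \<in> lcs H n \<and> y \<in> carrier H}
      = h ` {commutator G x y | x y. x \<in> lcs G n \<and> y \<in> carrier G}" (is "?L = h ` ?R")
  proof (intro equalityI subsetI)
    fix u assume "u \<in> ?L"
    then obtain x y where "x \<in> lcs G n" "y \<in> carrier G" "u = commutator H (h x) (h y)"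
      unfolding Suc surj by blast
    then show "u \<in> h ` ?R" using sub commutator_hom[OF gh, of x y] by (intro image_eqI[of _ _ "commutator G x y"]) auto
  next
    fix u assume "u \<in> h ` ?R"
    then obtain x y where "x \<in> lcs G n" "y \<in> carrier G" "u = h (commutator G x y)" by blast
    then show "u \<in> ?L" using sub commutator_hom[OF gh, of x y] unfolding Suc surj by blast
  qed
  moreover have "?R \<subseteq> carrier G" using sub by (auto simp: commutator_def)
  ultimately show ?case by (simp add: generate_img[symmetric])
qed

lemma nilpotency_class_iso:
  assumes "group G" "group H" "h \<in> iso G H" "nilpotency_class G k"
  shows "nilpotency_class H k"
proof -
  have gh: "group_hom G H h" using assms by (simp add: group_hom_def group_hom_axioms_def iso_def)
  interpret group_hom G H h by (rule gh)
  have "inj_on h (carrier G)" using assms(3) by (simp add: iso_def bij_betw_def)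
  then have inj: "h ` lcs G i = {\<one>\<^bsub>H\<^esub>} \<longleftrightarrow> lcs G i = {\<one>\<^bsub>G\<^esub>}" for i
    using inj_on_image_eq_iff[of h "carrier G" "lcs G i" "{\<one>\<^bsub>G\<^esub>}"] lcs_subset_carrier[OF assms(1), of i] by simp
  show ?thesis using assms(4) unfolding nilpotency_class_def lcs_iso[OF assms(1-3)] inj .
qed

section \<open>The presented group\<close>

lemma weq_context: assumes "weq \<alpha> \<beta> u v" shows "weq \<alpha> \<beta> (p @ u @ s) (p @ v @ s)"
  using assms
proof (induction rule: weq.induct)
  case (weq_cancel u x v)
  then show ?case using weq.weq_cancel[of \<alpha> \<beta> "p @ u" x "v @ s"] by simp
next
  case (weq_rel1 u v)
  then show ?case using weq.weq_rel1[of \<alpha> \<beta> "p @ u" "v @ s"] by simp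
next
  case (weq_rel2 u v)
  then show ?case using weq.weq_rel2[of \<alpha> \<beta> "p @ u" "v @ s"] by simp
qed (blast intro: weq.intros)+

lemma weq_append: assumes "weq \<alpha> \<beta> u u'" "weq \<alpha> \<beta> v v'" shows "weq \<alpha> \<beta> (u @ v) (u' @ v')"
  using weq_context[OF assms(1), of "[]" v] weq_context[OF assms(2), of u' "[]"] weq_trans by fastforce

lemma inv_letter_inv_letter [simp]: "inv_letter (inv_letter x) = x"
  by (simp add: inv_letter_def)

lemma weq_inv_word: "weq \<alpha> \<beta> (w @ inv_word w) []"
proof (induction w)
  case (Cons x w)
  have "weq \<alpha> \<beta> ([x] @ (w @ inv_word w) @ [inv_letter x]) ([x] @ [] @ [inv_letter x])"
    by (rule weq_context[OF Cons])
  moreover have "weq \<alpha> \<beta> ([x] @ [] @ [inv_letter x]) []" using weq_cancel[of \<alpha> \<beta> "[]" x "[]"] by simp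
  ultimately show ?case using weq_trans by (fastforce simp: inv_word_def)
qed (simp add: inv_word_def weq_refl)

lemma inv_word_inv_word [simp]: "inv_word (inv_word w) = w"
  by (simp add: inv_word_def rev_map comp_def)

lemma wclass_eq_iff: "wclass \<alpha> \<beta> u = wclass \<alpha> \<beta> v \<longleftrightarrow> weq \<alpha> \<beta> u v"
  unfolding wclass_def by (auto intro: weq.intros)

lemma Gpres_mult: "wclass \<alpha> \<beta> u \<otimes>\<^bsub>Gpres \<alpha> \<beta>\<^esub> wclass \<alpha> \<beta> v = wclass \<alpha> \<beta> (u @ v)"
  unfolding Gpres_def wclass_def by (auto intro: weq_trans weq_append weq_refl)

lemma Gpres_one: "\<one>\<^bsub>Gpres \<alpha> \<beta>\<^esub> = wclass \<alpha> \<beta> []"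
  by (simp add: Gpres_def)

lemma Gpres_carrier: "carrier (Gpres \<alpha> \<beta>) = range (wclass \<alpha> \<beta>)"
  by (simp add: Gpres_def)

lemma wclass_closed [simp]: "wclass \<alpha> \<beta> u \<in> carrier (Gpres \<alpha> \<beta>)"
  by (simp add: Gpres_carrier)

lemma group_Gpres: "group (Gpres \<alpha> \<beta>)"
proof (rule groupI)
  fix p assume "p \<in> carrier (Gpres \<alpha> \<beta>)"
  then obtain u where p: "p = wclass \<alpha> \<beta> u" by (auto simp: Gpres_carrier)
  have "wclass \<alpha> \<beta> (inv_word u) \<otimes>\<^bsub>Gpres \<alpha> \<beta>\<^esub> p = \<one>\<^bsub>Gpres \<alpha> \<beta>\<^esub>"
    using weq_inv_word[of \<alpha> \<beta> "inv_word u"] by (simp add: p Gpres_mult Gpres_one wclass_eq_iff)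
  then show "\<exists>q\<in>carrier (Gpres \<alpha> \<beta>). q \<otimes>\<^bsub>Gpres \<alpha> \<beta>\<^esub> p = \<one>\<^bsub>Gpres \<alpha> \<beta>\<^esub>" by (blast intro: wclass_closed)
qed (auto simp: Gpres_carrier Gpres_mult Gpres_one)

lemma Gpres_inv: "inv\<^bsub>Gpres \<alpha> \<beta>\<^esub> wclass \<alpha> \<beta> u = wclass \<alpha> \<beta> (inv_word u)"
proof -
  interpret group "Gpres \<alpha> \<beta>" by (rule group_Gpres)
  show ?thesis
    using weq_inv_word[of \<alpha> \<beta> "inv_word u"]
    by (intro inv_equality) (simp_all add: Gpres_mult Gpres_one wclass_eq_iff)
qed

lemma Gpres_int_pow: "wclass \<alpha> \<beta> u [^]\<^bsub>Gpres \<alpha> \<beta>\<^esub> i = wclass \<alpha> \<beta> (wpow u i)" for i :: int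
proof -
  interpret group "Gpres \<alpha> \<beta>" by (rule group_Gpres)
  have nat: "wclass \<alpha> \<beta> u [^]\<^bsub>Gpres \<alpha> \<beta>\<^esub> (n::nat) = wclass \<alpha> \<beta> (concat (replicate n u))" for u n
  proof (induction n)
    case (Suc n)
    have "concat (replicate (Suc n) u) = concat (replicate n u) @ u"
      by (metis concat_append concat.simps append_Nil2 replicate_Suc replicate_append_same)
    then show ?case using Suc by (simp add: Gpres_mult)
  qed (simp add: Gpres_one)
  show ?thesis
  proof (cases "0 \<le> i")
    case True
    then show ?thesis using nat[of u "nat i"] int_pow_int[of "Gpres \<alpha> \<beta>" "wclass \<alpha> \<beta> u" "nat i"]
      by (simp add: wpow_def)
  next
    case False
    then have "wclass \<alpha> \<beta> u [^]\<^bsub>Gpres \<alpha> \<beta>\<^esub> i = inv\<^bsub>Gpres \<alpha> \<beta>\<^esub> (wclass \<alpha> \<beta> u [^]\<^bsub>Gpres \<alpha> \<beta>\<^esub> nat (- i))"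
      using int_pow_neg_int[of "wclass \<alpha> \<beta> u" "nat (- i)"] by simp
    also have "\<dots> = wclass \<alpha> \<beta> (inv_word u) [^]\<^bsub>Gpres \<alpha> \<beta>\<^esub> nat (- i)"
      by (simp only: nat_pow_inv[symmetric] wclass_closed Gpres_inv)
    finally show ?thesis using False by (simp add: nat wpow_def)
  qed
qed

lemma Gpres_macdonald:
  "macdonald (Gpres \<alpha> \<beta>) (wclass \<alpha> \<beta> wA) (wclass \<alpha> \<beta> wB) (wclass \<alpha> \<beta> wC) \<alpha> \<beta>"
proof -
  interpret group "Gpres \<alpha> \<beta>" by (rule group_Gpres)
  let ?A = "wclass \<alpha> \<beta> wA" and ?B = "wclass \<alpha> \<beta> wB" and ?C = "wclass \<alpha> \<beta> wC"
  show ?thesis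
  proof unfold_locales
    have "weq \<alpha> \<beta> ([] @ (wA @ inv_word wA) @ (inv_word wB @ wA @ wB)) ([] @ [] @ (inv_word wB @ wA @ wB))"
      by (rule weq_context[OF weq_inv_word])
    then have "wclass \<alpha> \<beta> (wA @ wC) = wclass \<alpha> \<beta> (inv_word wB @ wA @ wB)"
      unfolding wclass_eq_iff wC_def by simp
    then show "cj ?B ?A = ?A \<otimes>\<^bsub>Gpres \<alpha> \<beta>\<^esub> ?C" by (simp add: cj_def Gpres_inv Gpres_mult)
    show "cj ?C ?A = ?A [^]\<^bsub>Gpres \<alpha> \<beta>\<^esub> \<alpha>"
      using weq_rel1[of \<alpha> \<beta> "[]" "[]"] by (simp add: cj_def Gpres_inv Gpres_mult Gpres_int_pow wclass_eq_iff)
    show "cj (inv\<^bsub>Gpres \<alpha> \<beta>\<^esub> ?C) ?B = ?B [^]\<^bsub>Gpres \<alpha> \<beta>\<^esub> \<beta>"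
      using weq_rel2[of \<alpha> \<beta> "[]" "[]"] by (simp add: cj_def Gpres_inv Gpres_mult Gpres_int_pow wclass_eq_iff)
  qed simp_all
qed

lemma Gpres_generated:
  assumes "\<one>\<^bsub>Gpres \<alpha> \<beta>\<^esub> \<in> S"
    and step: "\<And>g s. g \<in> {wclass \<alpha> \<beta> wA, wclass \<alpha> \<beta> wB, inv\<^bsub>Gpres \<alpha> \<beta>\<^esub> wclass \<alpha> \<beta> wA, inv\<^bsub>Gpres \<alpha> \<beta>\<^esub> wclass \<alpha> \<beta> wB}
      \<Longrightarrow> s \<in> S \<Longrightarrow> s \<in> carrier (Gpres \<alpha> \<beta>) \<Longrightarrow> g \<otimes>\<^bsub>Gpres \<alpha> \<beta>\<^esub> s \<in> S"
  shows "carrier (Gpres \<alpha> \<beta>) \<subseteq> S"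
proof -
  have "wclass \<alpha> \<beta> w \<in> S" for w
  proof (induction w)
    case Nil
    then show ?case using assms(1) by (simp add: Gpres_one)
  next
    case (Cons x w)
    obtain g i where x: "x = (g, i)" by (cases x)
    have "wclass \<alpha> \<beta> [x] \<in> {wclass \<alpha> \<beta> wA, wclass \<alpha> \<beta> wB, inv\<^bsub>Gpres \<alpha> \<beta>\<^esub> wclass \<alpha> \<beta> wA, inv\<^bsub>Gpres \<alpha> \<beta>\<^esub> wclass \<alpha> \<beta> wB}"
      unfolding x by (cases g; cases i) (simp_all add: Gpres_inv wA_def wB_def inv_word_def inv_letter_def)
    from step[OF this Cons] show ?case by (simp add: Gpres_mult)
  qed
  then show ?thesis by (auto simp: Gpres_carrier)
qed

section \<open>Evaluation of words in a group\<close>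

context group
begin

definition eval_letter :: "'a \<Rightarrow> 'a \<Rightarrow> letter \<Rightarrow> 'a" where
  "eval_letter a b l = (let g = if fst l then b else a in if snd l then inv g else g)"

definition eval_word :: "'a \<Rightarrow> 'a \<Rightarrow> word \<Rightarrow> 'a" where
  "eval_word a b w = foldr (\<lambda>l g. eval_letter a b l \<otimes> g) w \<one>"

context
  fixes a b assumes ab [simp]: "a \<in> carrier G" "b \<in> carrier G"
begin

lemma eval_letter_closed [simp]: "eval_letter a b l \<in> carrier G"
  by (simp add: eval_letter_def Let_def)

lemma eval_word_closed [simp]: "eval_word a b w \<in> carrier G"
  by (induction w) (simp_all add: eval_word_def)

lemma eval_word_append: "eval_word a b (u @ v) = eval_word a b u \<otimes> eval_word a b v"
proof (induction u)
  case Nil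
  then show ?case using eval_word_closed[of v] by (simp add: eval_word_def)
next
  case (Cons x u)
  have c: "eval_word a b (x # w) = eval_letter a b x \<otimes> eval_word a b w" for w by (simp add: eval_word_def)
  show ?case using Cons by (simp add: c m_assoc)
qed

lemma eval_letter_inv: "eval_letter a b (inv_letter l) = inv (eval_letter a b l)"
  by (simp add: eval_letter_def inv_letter_def Let_def)

lemma eval_word_single: "eval_word a b [l] = eval_letter a b l"
  by (simp add: eval_word_def)

lemma eval_word_Nil: "eval_word a b [] = \<one>"
  by (simp add: eval_word_def)

lemma eval_word_inv: "eval_word a b (inv_word w) = inv (eval_word a b w)"
proof (induction w)
  case (Cons x w)
  have "eval_word a b (inv_word (x # w)) = eval_word a b (inv_word w) \<otimes> eval_word a b [inv_letter x]"
    by (simp add: inv_word_def flip: eval_word_append)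
  moreover have "eval_word a b (x # w) = eval_word a b [x] \<otimes> eval_word a b w"
    by (simp flip: eval_word_append)
  ultimately show ?case using Cons by (simp add: eval_word_single eval_letter_inv inv_mult_group)
qed (simp add: inv_word_def eval_word_Nil)

lemma eval_word_wpow: "eval_word a b (wpow w i) = eval_word a b w [^] i"
proof -
  have nat: "eval_word a b (concat (replicate n w)) = eval_word a b w [^] n" for n w
  proof (induction n)
    case (Suc n)
    have "eval_word a b w [^] Suc n = eval_word a b w \<otimes> eval_word a b w [^] n" by (rule nat_pow_Suc2) simp
    then show ?case using Suc by (simp add: eval_word_append del: nat_pow_Suc)
  qed (simp add: eval_word_Nil)
  show ?thesis
  proof (cases "0 \<le> i")
    case True
    then show ?thesis using nat[of "nat i" w] int_pow_int[of G "eval_word a b w" "nat i"] by (simp add: wpow_def)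
  next
    case False
    then have "eval_word a b w [^] i = inv (eval_word a b w [^] nat (- i))"
      using int_pow_neg_int[of "eval_word a b w" "nat (- i)"] by simp
    then show ?thesis using False nat[of "nat (- i)" "inv_word w"]
      by (simp add: wpow_def eval_word_inv nat_pow_inv int_pow_inv)
  qed
qed

lemma eval_word_weq:
  assumes "cj (commutator G a b) a = a [^] \<alpha>" "cj (inv (commutator G a b)) b = b [^] \<beta>"
    and "weq \<alpha> \<beta> u v"
  shows "eval_word a b u = eval_word a b v"
  using assms(3)
proof (induction rule: weq.induct)
  have A: "eval_word a b wA = a" and B: "eval_word a b wB = b"
    by (simp_all add: eval_word_def eval_letter_def wA_def wB_def)
  have C: "eval_word a b wC = commutator G a b"
    by (simp add: wC_def eval_word_append eval_word_inv A B commutator_def m_assoc)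
  have cc: "commutator G a b \<in> carrier G" by (simp add: commutator_def)
  {
    case (weq_cancel u x v)
    have "eval_word a b [x, inv_letter x] = \<one>"
      using eval_word_append[of "[x]" "[inv_letter x]"] by (simp add: eval_word_single eval_letter_inv)
    then show ?case by (simp add: eval_word_append del: append_Cons append_Nil)
  next
    case (weq_rel1 u v)
    have "eval_word a b (inv_word wC @ wA @ wC) = eval_word a b (wpow wA \<alpha>)"
      using assms(1) cc by (simp add: eval_word_append eval_word_inv eval_word_wpow A C cj_def m_assoc)
    then have "eval_word a b (u @ (inv_word wC @ wA @ wC) @ v) = eval_word a b (u @ wpow wA \<alpha> @ v)"
      by (simp only: eval_word_append)
    then show ?case by simp
  next
    case (weq_rel2 u v)
    have "eval_word a b (wC @ wB @ inv_word wC) = eval_word a b (wpow wB \<beta>)"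
      using assms(2) cc by (simp add: eval_word_append eval_word_inv eval_word_wpow B C cj_def m_assoc)
    then have "eval_word a b (u @ (wC @ wB @ inv_word wC) @ v) = eval_word a b (u @ wpow wB \<beta> @ v)"
      by (simp only: eval_word_append)
    then show ?case by simp
  }
qed simp_all

text \<open>Universal property of the presentation; equivalent words have equal values, so the
  chosen representative does not matter.\<close>

lemma hom_from_Gpres:
  assumes rel: "cj (commutator G a b) a = a [^] \<alpha>" "cj (inv (commutator G a b)) b = b [^] \<beta>"
  shows "\<exists>\<phi>\<in>hom (Gpres \<alpha> \<beta>) G. \<phi> (wclass \<alpha> \<beta> wA) = a \<and> \<phi> (wclass \<alpha> \<beta> wB) = b"
proof -
  define \<phi> where "\<phi> p = eval_word a b (SOME w. p = wclass \<alpha> \<beta> w)" for p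
  have \<phi>: "\<phi> (wclass \<alpha> \<beta> w) = eval_word a b w" for w
  proof -
    have "wclass \<alpha> \<beta> w = wclass \<alpha> \<beta> (SOME v. wclass \<alpha> \<beta> w = wclass \<alpha> \<beta> v)"
      by (rule someI[of "\<lambda>v. wclass \<alpha> \<beta> w = wclass \<alpha> \<beta> v"]) simp
    then show ?thesis unfolding \<phi>_def using eval_word_weq[OF rel] wclass_eq_iff by metis
  qed
  have "\<phi> \<in> hom (Gpres \<alpha> \<beta>) G"
    by (rule homI) (auto simp: Gpres_carrier Gpres_mult \<phi> eval_word_append)
  moreover have "\<phi> (wclass \<alpha> \<beta> wA) = a" "\<phi> (wclass \<alpha> \<beta> wB) = b"
    by (simp_all add: \<phi> eval_word_def eval_letter_def wA_def wB_def)
  ultimately show ?thesis by blast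
qed

end

end

text \<open>The commutator of the two images is \<open>(2, 0)\<close>, and conjugation by it or its
  inverse inverts both. Their fourth powers are trivial and the exponents are -1 modulo 4, so the
  relations demand exactly these inverses.\<close>

lemma hom_Gpres_Q16:
  assumes "\<alpha> mod 4 = 3" "\<beta> mod 4 = 3"
  shows "\<exists>\<phi>\<in>hom (Gpres \<alpha> \<beta>) Q16. \<phi> (wclass \<alpha> \<beta> wA) = (0, 1) \<and> \<phi> (wclass \<alpha> \<beta> wB) = (3, 1)"
proof -
  interpret Q: group Q16 by (rule group_Q16)
  have c: "(0, 1) \<in> carrier Q16" "(3, 1) \<in> carrier Q16" "(2, 0) \<in> carrier Q16" "(6, 0) \<in> carrier Q16" by (simp_all add: Q16_carrier)
  have C: "commutator Q16 (0, 1) (3, 1) = (2, 0)" using c by (simp add: Q16_commutator)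
  have pow: "y [^]\<^bsub>Q16\<^esub> i = inv\<^bsub>Q16\<^esub> y" if "y \<in> {(0, 1), (3, 1)}" "i mod 4 = 3" for y and i :: int
  proof -
    have yc: "y \<in> carrier Q16" using that c by auto
    have "y [^]\<^bsub>Q16\<^esub> (4::nat) = \<one>\<^bsub>Q16\<^esub>" using that(1) by (auto simp: eval_nat_numeral Q16_mult Q16_one)
    then have "int (Q.ord y) dvd int 4" using yc by (simp only: Q.pow_eq_id int_dvd_int_iff)
    also have "int 4 dvd i - (- 1)" using that(2) by simp presburger
    finally have "int (Q.ord y) dvd i - (- 1)" .
    then have "y [^]\<^bsub>Q16\<^esub> i = y [^]\<^bsub>Q16\<^esub> (- 1 :: int)" using yc by (simp only: Q.int_pow_eq_iff_dvd)
    then show ?thesis using yc by (simp add: Q.int_pow_neg)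
  qed
  show ?thesis
  proof (rule Q.hom_from_Gpres[OF c(1,2)])
    show "Q.cj (commutator Q16 (0, 1) (3, 1)) (0, 1) = (0, 1) [^]\<^bsub>Q16\<^esub> \<alpha>"
      using c pow[of "(0, 1)" \<alpha>] assms by (simp add: C Q.cj_def Q16_inv Q16_mult)
    show "Q.cj (inv\<^bsub>Q16\<^esub> commutator Q16 (0, 1) (3, 1)) (3, 1) = (3, 1) [^]\<^bsub>Q16\<^esub> \<beta>"
      using c pow[of "(3, 1)" \<beta>] assms by (simp add: C Q.cj_def Q16_inv Q16_mult)
  qed
qed

lemma mod_4_if_multiplicity_2:
  fixes t :: int
  assumes "multiplicity 2 (t - 1) = 1" "t \<noteq> 1"
  shows "t mod 4 = 3"
proof -
  have "2 ^ 1 dvd t - 1" using assms(1) by (metis multiplicity_dvd)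
  moreover have "\<not> 2 ^ 2 dvd t - 1"
  proof
    assume "2 ^ 2 dvd t - 1"
    then have "2 \<le> multiplicity 2 (t - 1)" using assms(2) by (intro multiplicity_geI) auto
    then show False using assms(1) by simp
  qed
  ultimately show ?thesis by simp presburger
qed

theorem theorem12p1:
  fixes \<alpha> \<beta> :: int
  assumes "\<alpha> \<noteq> 1" and "\<beta> \<noteq> 1"
    and "multiplicity (2::int) (\<alpha> - 1) = 1" and "multiplicity (2::int) (\<beta> - 1) = 1"
  shows "card (carrier (sylow2 (Gpres \<alpha> \<beta>))) = 16
    \<and> nilpotency_class (sylow2 (Gpres \<alpha> \<beta>)) 3
    \<and> group.ord (Gpres \<alpha> \<beta>) (proj2 (Gpres \<alpha> \<beta>) (wclass \<alpha> \<beta> wA)) = 4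
    \<and> group.ord (Gpres \<alpha> \<beta>) (proj2 (Gpres \<alpha> \<beta>) (wclass \<alpha> \<beta> wB)) = 4
    \<and> group.ord (Gpres \<alpha> \<beta>) (proj2 (Gpres \<alpha> \<beta>) (wclass \<alpha> \<beta> wC)) = 4
    \<and> sylow2 (Gpres \<alpha> \<beta>) \<cong> Q16"
proof -
  let ?G = "Gpres \<alpha> \<beta>" and ?A = "wclass \<alpha> \<beta> wA" and ?B = "wclass \<alpha> \<beta> wB" and ?C = "wclass \<alpha> \<beta> wC"
  have mod4: "\<alpha> mod 4 = 3" "\<beta> mod 4 = 3" using assms by (simp_all add: mod_4_if_multiplicity_2)
  have odds: "odd \<alpha>" "odd \<beta>" using mod4 by presburger+
  interpret M: macdonald ?G ?A ?B ?C \<alpha> \<beta> by (rule Gpres_macdonald)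
  note pos = M.finite_orders[OF assms(1,2) mod4]
  have good: "\<not> M.bad q" for q by (rule M.prime_divisors_of_orders[OF pos odds])
  interpret g: good_macdonald ?G ?A ?B ?C \<alpha> \<beta>
    by unfold_locales (use pos mod4 good in \<open>auto simp: M.bad_def\<close>)
  obtain m where m: "m mod 4 = 1" "M.ord ?A dvd 4 * m" "M.ord ?B dvd 4 * m" by (rule g.obtain_exponent)
  obtain \<phi> where \<phi>: "\<phi> \<in> hom ?G Q16" "\<phi> ?A = (0, 1)" "\<phi> ?B = (3, 1)" using hom_Gpres_Q16[OF mod4] by blast
  interpret Q: macdonald_Q16 ?G ?A ?B ?C \<alpha> \<beta> m \<phi>
    by unfold_locales (fact m \<phi> Gpres_generated)+
  have grp: "group (sylow2 ?G)" unfolding Q.sylow2_eq by (rule M.subgroup_imp_group[OF Q.P_subgroup])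
  have "card (carrier (sylow2 ?G)) = 16" by (simp add: Q.sylow2_eq Q.card_P)
  moreover have "nilpotency_class (sylow2 ?G) 3"
    by (rule nilpotency_class_iso[OF group_Q16 grp Q.\<Psi>_iso nilpotency_class_Q16])
  moreover have "sylow2 ?G \<cong> Q16"
    using group.iso_sym[OF group_Q16] Q.\<Psi>_iso unfolding is_iso_def by blast
  ultimately show ?thesis using Q.ord_proj2 by simp
qed

end
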